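(* Let $A$ be the Lie ring given by the following presentation. Generators: $e_i,a_i,b_i$ for $i\in\{0,1,2,3\}$, and $u_{ij},v_{ij},w_{ij}$ for $0\le i<j\le3$. Write $y_i=[a_i,b_i]$ and $y_{ij}=[[u_{ij},v_{ij}],w_{ij}]$. Relations: $$3^{2i}e_i=y_i\ \text{ for } i\in\{0,1,2,3\},$$ $$3^{12-i}e_j+3^{12-j}e_i=3^{12-2i-2j}y_{ij}\ \text{ for }(i,j)\in\{(0,1),(0,2),(1,3),(2,3)\}.$$ Let $\omega=3^9[[e_2,e_1],e_0]\in A$. Then $\omega\in\delta_7(A)\setminus\gamma_7(A)$ and $3\omega\in\gamma_7(A)$.
   Context: A Lie ring is a Lie algebra over $\mathbb Z$. $\gamma_n(A)$ is the $n$th term of the lower central series of $A$ ($\gamma_1(A)=A$), $U(A)$ is the universal enveloping algebra of $A$, in which $A$ embeds, $\varpi$ is the augmentation ideal of $U(A)$, and $\delta_n(A)=A\cap\varpi^n$. *)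

theory Defs
  imports Main "HOL-Computational_Algebra.Group_Closure"
begin

section \<open>Lie rings\<close>

class lie_bracket =
  fixes lie :: "'a \<Rightarrow> 'a \<Rightarrow> 'a"  (\<open>\<langle>_,/ _\<rangle>\<close>)

class lie_ring = ab_group_add + lie_bracket +
  assumes lie_add_left: "\<langle>x + y, z\<rangle> = \<langle>x, z\<rangle> + \<langle>y, z\<rangle>"
    and lie_add_right: "\<langle>x, y + z\<rangle> = \<langle>x, y\<rangle> + \<langle>x, z\<rangle>"
    and lie_self: "\<langle>x, x\<rangle> = 0"
    and lie_jacobi: "\<langle>\<langle>x, y\<rangle>, z\<rangle> + \<langle>\<langle>y, z\<rangle>, x\<rangle> + \<langle>\<langle>z, x\<rangle>, y\<rangle> = 0"

text \<open>
  The multiple \<open>n x\<close>. The weak sort makes it available both in Lie rings and for the formal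
  Lie terms below, where addition satisfies no laws.
\<close>

primrec nmult :: "nat \<Rightarrow> 'a::{zero, plus} \<Rightarrow> 'a" where
  "nmult 0 x = 0"
| "nmult (Suc n) x = x + nmult n x"

definition lie_hom :: "('a::lie_ring \<Rightarrow> 'b::lie_ring) \<Rightarrow> bool" where
  "lie_hom h \<longleftrightarrow> (\<forall>x y. h (x + y) = h x + h y \<and> h \<langle>x, y\<rangle> = \<langle>h x, h y\<rangle>)"

text \<open>
  Lower central series: \<open>\<gamma>\<^sub>1 = L\<close> and \<open>\<gamma>\<^sub>n\<^sub>+\<^sub>1 = [\<gamma>\<^sub>n, L]\<close>, the additive subgroup generated by the
  brackets. The value at index \<open>0\<close> is a dummy.
\<close>

fun lower_central :: "nat \<Rightarrow> 'a::lie_ring set" where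
  "lower_central 0 = UNIV"
| "lower_central (Suc 0) = UNIV"
| "lower_central (Suc (Suc n)) =
     group_closure {\<langle>x, y\<rangle> | x y. x \<in> lower_central (Suc n)}"


section \<open>Lie rings given by generators and relations\<close>

datatype 'x lterm =
    LGen 'x
  | LZero
  | LPlus "'x lterm" "'x lterm"
  | LNeg "'x lterm"
  | LBr "'x lterm" "'x lterm"

instantiation lterm :: (type) "{zero, plus, uminus, lie_bracket}"
begin
definition "0 = LZero"
definition "s + t = LPlus s t"
definition "- t = LNeg t"
definition "\<langle>s, t\<rangle> = LBr s t"
instance ..
end

text \<open>
  The smallest congruence on Lie terms that contains the given relations and the Lie ring axioms.
  The quotient by it is the Lie ring presented by the generators \<open>'x\<close> and the relations \<open>R\<close>.
\<close>

inductive lie_cong :: "('x lterm \<times> 'x lterm) set \<Rightarrow> 'x lterm \<Rightarrow> 'x lterm \<Rightarrow> bool"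
  for R where
  lc_rel: "(s, t) \<in> R \<Longrightarrow> lie_cong R s t"
| lc_refl: "lie_cong R t t"
| lc_sym: "lie_cong R s t \<Longrightarrow> lie_cong R t s"
| lc_trans: "lie_cong R s t \<Longrightarrow> lie_cong R t u \<Longrightarrow> lie_cong R s u"
| lc_plus: "lie_cong R s s' \<Longrightarrow> lie_cong R t t' \<Longrightarrow> lie_cong R (s + t) (s' + t')"
| lc_neg: "lie_cong R t t' \<Longrightarrow> lie_cong R (- t) (- t')"
| lc_br: "lie_cong R s s' \<Longrightarrow> lie_cong R t t' \<Longrightarrow> lie_cong R \<langle>s, t\<rangle> \<langle>s', t'\<rangle>"
| lc_assoc: "lie_cong R (s + t + u) (s + (t + u))"
| lc_commute: "lie_cong R (s + t) (t + s)"
| lc_zero: "lie_cong R (0 + t) t"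
| lc_inverse: "lie_cong R (- t + t) 0"
| lc_br_left: "lie_cong R \<langle>s + t, u\<rangle> (\<langle>s, u\<rangle> + \<langle>t, u\<rangle>)"
| lc_br_right: "lie_cong R \<langle>s, t + u\<rangle> (\<langle>s, t\<rangle> + \<langle>s, u\<rangle>)"
| lc_self: "lie_cong R \<langle>t, t\<rangle> 0"
| lc_jacobi: "lie_cong R (\<langle>\<langle>s, t\<rangle>, u\<rangle> + \<langle>\<langle>t, u\<rangle>, s\<rangle> + \<langle>\<langle>u, s\<rangle>, t\<rangle>) 0"

lemma equivp_lie_cong: "equivp (lie_cong R)"
  by (intro equivpI reflpI sympI transpI) (fact lc_refl lc_sym lc_trans)+

primrec lterm_eval :: "('x \<Rightarrow> 'b::lie_ring) \<Rightarrow> 'x lterm \<Rightarrow> 'b" where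
  "lterm_eval f (LGen x) = f x"
| "lterm_eval f LZero = 0"
| "lterm_eval f (LPlus s t) = lterm_eval f s + lterm_eval f t"
| "lterm_eval f (LNeg t) = - lterm_eval f t"
| "lterm_eval f (LBr s t) = \<langle>lterm_eval f s, lterm_eval f t\<rangle>"

lemma lterm_eval_ops [simp]:
  "lterm_eval f 0 = 0"
  "lterm_eval f (s + t) = lterm_eval f s + lterm_eval f t"
  "lterm_eval f (- t) = - lterm_eval f t"
  "lterm_eval f \<langle>s, t\<rangle> = \<langle>lterm_eval f s, lterm_eval f t\<rangle>"
  by (simp_all add: zero_lterm_def plus_lterm_def uminus_lterm_def lie_lterm_def)

lemma lterm_eval_nmult [simp]: "lterm_eval f (nmult n t) = nmult n (lterm_eval f t)"
  by (induction n) simp_all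

lemma lterm_eval_cong:
  assumes "lie_cong R s t" and "\<And>s t. (s, t) \<in> R \<Longrightarrow> lterm_eval f s = lterm_eval f t"
  shows "lterm_eval f s = lterm_eval f t"
  using assms(1)
proof (induction rule: lie_cong.induct)
  case (lc_rel s t)
  then show ?case by (rule assms(2))
next
  case (lc_jacobi s t u)
  then show ?case by (simp add: lie_jacobi)
qed (simp_all add: lie_add_left lie_add_right lie_self add_ac)


section \<open>The Lie ring \<open>A\<close>\<close>

datatype gen_label = GE nat | GA nat | GB nat | GU nat nat | GV nat nat | GW nat nat

definition gen_labels :: "gen_label set" where
  "gen_labels =
     {GE i | i. i \<le> 3} \<union> {GA i | i. i \<le> 3} \<union> {GB i | i. i \<le> 3} \<union>
     {GU i j | i j. i < j \<and> j \<le> 3} \<union> {GV i j | i j. i < j \<and> j \<le> 3} \<union>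
     {GW i j | i j. i < j \<and> j \<le> 3}"

typedef gen = gen_labels
proof
  show "GE 0 \<in> gen_labels" by (simp add: gen_labels_def)
qed

text \<open>
  \<^const>\<open>Abs_gen\<close> is unspecified outside \<^const>\<open>gen_labels\<close>, so \<open>lgen\<close> is only to be used on labels
  of actual generators.
\<close>

abbreviation lgen :: "gen_label \<Rightarrow> gen lterm" where
  "lgen l \<equiv> LGen (Abs_gen l)"

definition y_term :: "nat \<Rightarrow> gen lterm" where
  "y_term i = \<langle>lgen (GA i), lgen (GB i)\<rangle>"

definition yy_term :: "nat \<Rightarrow> nat \<Rightarrow> gen lterm" where
  "yy_term i j = \<langle>\<langle>lgen (GU i j), lgen (GV i j)\<rangle>, lgen (GW i j)\<rangle>"

definition A_rels :: "(gen lterm \<times> gen lterm) set" where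
  "A_rels =
     {(nmult (3 ^ (2 * i)) (lgen (GE i)), y_term i) | i. i \<in> {0, 1, 2, 3}} \<union>
     {(nmult (3 ^ (12 - i)) (lgen (GE j)) + nmult (3 ^ (12 - j)) (lgen (GE i)),
       nmult (3 ^ (12 - 2 * i - 2 * j)) (yy_term i j)) | i j.
         (i, j) \<in> {(0, 1), (0, 2), (1, 3), (2, 3)}}"

quotient_type lie_A = "gen lterm" / "lie_cong A_rels"
  by (rule equivp_lie_cong)

instantiation lie_A :: lie_ring
begin

lift_definition zero_lie_A :: lie_A is 0 .
lift_definition plus_lie_A :: "lie_A \<Rightarrow> lie_A \<Rightarrow> lie_A" is "(+)" by (rule lc_plus)
lift_definition uminus_lie_A :: "lie_A \<Rightarrow> lie_A" is uminus by (rule lc_neg)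
lift_definition lie_lie_A :: "lie_A \<Rightarrow> lie_A \<Rightarrow> lie_A" is lie by (rule lc_br)
definition minus_lie_A :: "lie_A \<Rightarrow> lie_A \<Rightarrow> lie_A" where "minus_lie_A x y = x + - y"

instance
proof
  fix x y z :: lie_A
  show "x + y + z = x + (y + z)" by transfer (rule lc_assoc)
  show "x + y = y + x" by transfer (rule lc_commute)
  show "0 + x = x" by transfer (rule lc_zero)
  show "- x + x = 0" by transfer (rule lc_inverse)
  show "x - y = x + - y" by (rule minus_lie_A_def)
  show "\<langle>x + y, z\<rangle> = \<langle>x, z\<rangle> + \<langle>y, z\<rangle>" by transfer (rule lc_br_left)
  show "\<langle>x, y + z\<rangle> = \<langle>x, y\<rangle> + \<langle>x, z\<rangle>" by transfer (rule lc_br_right)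
  show "\<langle>x, x\<rangle> = 0" by transfer (rule lc_self)
  show "\<langle>\<langle>x, y\<rangle>, z\<rangle> + \<langle>\<langle>y, z\<rangle>, x\<rangle> + \<langle>\<langle>z, x\<rangle>, y\<rangle> = 0" by transfer (rule lc_jacobi)
qed

end

lift_definition A_gen :: "gen \<Rightarrow> lie_A" is LGen .

definition e :: "nat \<Rightarrow> lie_A" where "e i = A_gen (Abs_gen (GE i))"

lift_definition A_eval :: "gen lterm \<Rightarrow> lie_A" is "\<lambda>t. t" .

lemma A_eval_eq: "A_eval t = lterm_eval A_gen t"
proof (induction t)
  case (LGen x)
  show ?case by simp (transfer, rule lc_refl)
next
  case LZero
  show ?case by simp (transfer, simp add: zero_lterm_def lc_refl)
next
  case (LPlus s t)
  have "A_eval (LPlus s t) = A_eval s + A_eval t"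
    by transfer (simp add: plus_lterm_def lc_refl)
  with LPlus show ?case by simp
next
  case (LNeg t)
  have "A_eval (LNeg t) = - A_eval t" by transfer (simp add: uminus_lterm_def lc_refl)
  with LNeg show ?case by simp
next
  case (LBr s t)
  have "A_eval (LBr s t) = \<langle>A_eval s, A_eval t\<rangle>" by transfer (simp add: lie_lterm_def lc_refl)
  with LBr show ?case by simp
qed

theorem A_relations:
  assumes "(s, t) \<in> A_rels"
  shows "lterm_eval A_gen s = lterm_eval A_gen t"
proof -
  have "A_eval s = A_eval t" using assms by transfer (rule lc_rel)
  then show ?thesis by (simp add: A_eval_eq)
qed

theorem A_universal:
  fixes f :: "gen \<Rightarrow> 'b::lie_ring"
  assumes "\<And>s t. (s, t) \<in> A_rels \<Longrightarrow> lterm_eval f s = lterm_eval f t"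
  shows "\<exists>!h. lie_hom h \<and> (\<forall>g. h (A_gen g) = f g)"
proof (rule ex1I)
  define h where "h x = lterm_eval f (rep_lie_A x)" for x
  have h: "h (abs_lie_A t) = lterm_eval f t" for t
    unfolding h_def
    by (rule lterm_eval_cong[OF rep_abs_rsp_left[OF Quotient3_lie_A lc_refl] assms])
  have "h (x + y) = h x + h y" for x y
    by (induct x rule: lie_A.abs_induct, induct y rule: lie_A.abs_induct)
      (simp add: plus_lie_A.abs_eq h)
  moreover have "h \<langle>x, y\<rangle> = \<langle>h x, h y\<rangle>" for x y
    by (induct x rule: lie_A.abs_induct, induct y rule: lie_A.abs_induct)
      (simp add: lie_lie_A.abs_eq h)
  ultimately show "lie_hom h \<and> (\<forall>g. h (A_gen g) = f g)"
    by (simp add: lie_hom_def A_gen.abs_eq h)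
  fix k assume k: "lie_hom k \<and> (\<forall>g. k (A_gen g) = f g)"
  have kp: "k (x + y) = k x + k y" and kb: "k \<langle>x, y\<rangle> = \<langle>k x, k y\<rangle>" for x y
    using k by (auto simp: lie_hom_def)
  have k0: "k 0 = 0" using kp[of 0 0] by simp
  have kn: "k (- x) = - k x" for x
    using kp[of x "- x"] by (simp add: k0 eq_neg_iff_add_eq_0 add.commute)
  have "k (lterm_eval A_gen t) = lterm_eval f t" for t
    by (induction t) (simp_all add: k kp kb k0 kn)
  then have "k (abs_lie_A t) = h (abs_lie_A t)" for t
    by (simp add: h A_eval_eq[symmetric] A_eval.abs_eq)
  then have "k x = h x" for x by (induct x rule: lie_A.abs_induct)
  then show "k = h" by (rule ext)
qed


section \<open>The universal enveloping algebra\<close>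

text \<open>
  The unital associative ring generated by the elements of a Lie ring \<open>L\<close>, subject to
  additivity of the inclusion of \<open>L\<close> and \<open>[x, y] = x y - y x\<close>; that is, the tensor ring of \<open>L\<close>
  modulo the latter relations.
\<close>

datatype 'a uterm =
    UIncl 'a
  | UZero
  | UOne
  | UPlus "'a uterm" "'a uterm"
  | UNeg "'a uterm"
  | UTimes "'a uterm" "'a uterm"

inductive uea_cong :: "'a::lie_ring uterm \<Rightarrow> 'a uterm \<Rightarrow> bool" where
  uc_refl: "uea_cong t t"
| uc_sym: "uea_cong s t \<Longrightarrow> uea_cong t s"
| uc_trans: "uea_cong s t \<Longrightarrow> uea_cong t u \<Longrightarrow> uea_cong s u"
| uc_plus: "uea_cong s s' \<Longrightarrow> uea_cong t t' \<Longrightarrow> uea_cong (UPlus s t) (UPlus s' t')"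
| uc_neg: "uea_cong t t' \<Longrightarrow> uea_cong (UNeg t) (UNeg t')"
| uc_times: "uea_cong s s' \<Longrightarrow> uea_cong t t' \<Longrightarrow> uea_cong (UTimes s t) (UTimes s' t')"
| uc_assoc: "uea_cong (UPlus (UPlus s t) u) (UPlus s (UPlus t u))"
| uc_commute: "uea_cong (UPlus s t) (UPlus t s)"
| uc_zero: "uea_cong (UPlus UZero t) t"
| uc_inverse: "uea_cong (UPlus (UNeg t) t) UZero"
| uc_times_assoc: "uea_cong (UTimes (UTimes s t) u) (UTimes s (UTimes t u))"
| uc_one_left: "uea_cong (UTimes UOne t) t"
| uc_one_right: "uea_cong (UTimes t UOne) t"
| uc_distrib_right: "uea_cong (UTimes (UPlus s t) u) (UPlus (UTimes s u) (UTimes t u))"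
| uc_distrib_left: "uea_cong (UTimes s (UPlus t u)) (UPlus (UTimes s t) (UTimes s u))"
| uc_incl_add: "uea_cong (UIncl (x + y)) (UPlus (UIncl x) (UIncl y))"
| uc_incl_lie: "uea_cong (UIncl \<langle>x, y\<rangle>)
    (UPlus (UTimes (UIncl x) (UIncl y)) (UNeg (UTimes (UIncl y) (UIncl x))))"

primrec uterm_eval :: "('a \<Rightarrow> 'r::ring_1) \<Rightarrow> 'a uterm \<Rightarrow> 'r" where
  "uterm_eval f (UIncl x) = f x"
| "uterm_eval f UZero = 0"
| "uterm_eval f UOne = 1"
| "uterm_eval f (UPlus s t) = uterm_eval f s + uterm_eval f t"
| "uterm_eval f (UNeg t) = - uterm_eval f t"
| "uterm_eval f (UTimes s t) = uterm_eval f s * uterm_eval f t"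

lemma uterm_eval_cong:
  fixes f :: "'a::lie_ring \<Rightarrow> 'r::ring_1"
  assumes "uea_cong s t"
    and "\<And>x y. f (x + y) = f x + f y" and "\<And>x y. f \<langle>x, y\<rangle> = f x * f y - f y * f x"
  shows "uterm_eval f s = uterm_eval f t"
  using assms(1) by (induction rule: uea_cong.induct) (simp_all add: assms(2,3) algebra_simps)

quotient_type (overloaded) 'a uea = "'a::lie_ring uterm" / uea_cong
  by (intro equivpI reflpI sympI transpI) (fact uc_refl uc_sym uc_trans)+

instantiation uea :: (lie_ring) ring_1
begin

lift_definition zero_uea :: "'a uea" is UZero .
lift_definition one_uea :: "'a uea" is UOne .
lift_definition plus_uea :: "'a uea \<Rightarrow> 'a uea \<Rightarrow> 'a uea" is UPlus by (rule uc_plus)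
lift_definition uminus_uea :: "'a uea \<Rightarrow> 'a uea" is UNeg by (rule uc_neg)
lift_definition times_uea :: "'a uea \<Rightarrow> 'a uea \<Rightarrow> 'a uea" is UTimes by (rule uc_times)
definition minus_uea :: "'a uea \<Rightarrow> 'a uea \<Rightarrow> 'a uea" where "minus_uea x y = x + - y"

instance
proof
  fix x y z :: "'a uea"
  show "x + y + z = x + (y + z)" by transfer (rule uc_assoc)
  show "x + y = y + x" by transfer (rule uc_commute)
  show "0 + x = x" by transfer (rule uc_zero)
  show "- x + x = 0" by transfer (rule uc_inverse)
  show "x - y = x + - y" by (rule minus_uea_def)
  show "x * y * z = x * (y * z)" by transfer (rule uc_times_assoc)
  show "1 * x = x" by transfer (rule uc_one_left)
  show "x * 1 = x" by transfer (rule uc_one_right)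
  show "(x + y) * z = x * z + y * z" by transfer (rule uc_distrib_right)
  show "x * (y + z) = x * y + x * z" by transfer (rule uc_distrib_left)
  have "uterm_eval (\<lambda>_::'a. 0::int) s = uterm_eval (\<lambda>_. 0) t" if "uea_cong s t" for s t
    using that by (rule uterm_eval_cong) simp_all
  then have "\<not> uea_cong (UZero :: 'a uterm) UOne" by fastforce
  then show "(0 :: 'a uea) \<noteq> 1" by transfer
qed

end

lift_definition uea_incl :: "'a::lie_ring \<Rightarrow> 'a uea" is UIncl .

lemma uea_incl_add: "uea_incl (x + y) = uea_incl x + uea_incl y"
  by transfer (rule uc_incl_add)

lemma uea_incl_lie: "uea_incl \<langle>x, y\<rangle> = uea_incl x * uea_incl y - uea_incl y * uea_incl x"
  unfolding minus_uea_def by transfer (rule uc_incl_lie)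

theorem uea_universal:
  fixes f :: "'a::lie_ring \<Rightarrow> 'r::ring_1"
  assumes f: "\<And>x y. f (x + y) = f x + f y" "\<And>x y. f \<langle>x, y\<rangle> = f x * f y - f y * f x"
  shows "\<exists>!h. h 1 = 1 \<and> (\<forall>u v. h (u + v) = h u + h v \<and> h (u * v) = h u * h v) \<and>
    (\<forall>x. h (uea_incl x) = f x)"
proof (rule ex1I)
  define h where "h u = uterm_eval f (rep_uea u)" for u
  have h: "h (abs_uea t) = uterm_eval f t" for t
  proof -
    have "uea_cong (rep_uea (abs_uea t)) t"
      by (rule rep_abs_rsp_left[OF Quotient3_uea uc_refl])
    then show ?thesis unfolding h_def using f by (rule uterm_eval_cong)
  qed
  have "h (x + y) = h x + h y" for x y
    by (induct x rule: uea.abs_induct, induct y rule: uea.abs_induct)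
      (simp add: plus_uea.abs_eq h)
  moreover have "h (x * y) = h x * h y" for x y
    by (induct x rule: uea.abs_induct, induct y rule: uea.abs_induct)
      (simp add: times_uea.abs_eq h)
  ultimately show "h 1 = 1 \<and> (\<forall>u v. h (u + v) = h u + h v \<and> h (u * v) = h u * h v) \<and>
      (\<forall>x. h (uea_incl x) = f x)"
    by (simp add: one_uea.abs_eq uea_incl.abs_eq h)
  fix k assume k: "k 1 = 1 \<and> (\<forall>u v. k (u + v) = k u + k v \<and> k (u * v) = k u * k v) \<and>
      (\<forall>x. k (uea_incl x) = f x)"
  have kp: "k (x + y) = k x + k y" for x y using k by blast
  have k0: "k 0 = 0" using kp[of 0 0] by simp
  have kn: "k (- x) = - k x" for x
    using kp[of x "- x"] by (simp add: k0 eq_neg_iff_add_eq_0 add.commute)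
  have "k (abs_uea t) = uterm_eval f t" for t
    by (induction t)
      (use k in \<open>simp_all add: k0 kn flip: uea_incl.abs_eq zero_uea.abs_eq one_uea.abs_eq
        plus_uea.abs_eq uminus_uea.abs_eq times_uea.abs_eq\<close>)
  then have "k (abs_uea t) = h (abs_uea t)" for t by (simp add: h)
  then have "k x = h x" for x by (induct x rule: uea.abs_induct)
  then show "k = h" by (rule ext)
qed

text \<open>The augmentation is the ring homomorphism \<open>U(L) \<rightarrow> \<int>\<close> that vanishes on \<open>L\<close>.\<close>

lift_definition uea_aug :: "'a::lie_ring uea \<Rightarrow> int" is "uterm_eval (\<lambda>_. 0)"
  by (erule uterm_eval_cong) simp_all

definition aug_ideal :: "'a::lie_ring uea set" where
  "aug_ideal = {u. uea_aug u = 0}"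

primrec ideal_power :: "'r::ring_1 set \<Rightarrow> nat \<Rightarrow> 'r set" where
  "ideal_power I 0 = UNIV"
| "ideal_power I (Suc n) = group_closure {x * y | x y. x \<in> ideal_power I n \<and> y \<in> I}"

text \<open>
  The intersection of \<open>L\<close> with the \<open>n\<close>-th power of the augmentation ideal, where \<open>L\<close> is regarded
  as a subset of \<open>U(L)\<close> via \<^const>\<open>uea_incl\<close>, which is injective because \<open>\<int>\<close> is a principal
  ideal domain (this is not proved here).
\<close>

definition dim_subring :: "nat \<Rightarrow> 'a::lie_ring set" where
  "dim_subring n = {x. uea_incl x \<in> ideal_power aug_ideal n}"

end

theory Submission
  imports Defs "HOL-Computational_Algebra.Polynomial" "HOL-Library.Function_Algebras"
begin

text \<open>
  Write \<open>X\<^sub>i\<^sub>j = 3\<^bsup>12-i\<^esup> e\<^sub>j + 3\<^bsup>12-j\<^esup> e\<^sub>i\<close>. In \<open>A\<close>, the element \<open>9\<^bsup>i\<^esup> e\<^sub>i = y\<^sub>i\<close> is a commutator of weight 2, and for the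
  four pairs \<open>01\<close>, \<open>02\<close>, \<open>13\<close>, \<open>23\<close>, \<open>X\<^sub>i\<^sub>j = 3\<^bsup>12-2i-2j\<^esup> y\<^sub>i\<^sub>j\<close> with a commutator \<open>y\<^sub>i\<^sub>j\<close> of weight 3.

  \<^emph>\<open>Membership in the dimension subring.\<close> If \<open>ij\<close> is one of the four pairs and \<open>k\<close>, \<open>l\<close> are
  the other two indices, then \<open>12 - 2i - 2j = 2k + 2l\<close>. Hence a product of \<open>X\<^sub>i\<^sub>j\<close>, \<open>e\<^sub>k\<close>, \<open>e\<^sub>l\<close>
  in any order equals the product of
  \<open>y\<^sub>i\<^sub>j\<close>, \<open>y\<^sub>k\<close>, \<open>y\<^sub>l\<close> in the corresponding order and lies in the seventh power of the augmentation ideal. Modulo that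
  power one may therefore replace a letter \<open>e\<^sub>j\<close> of a word in three distinct letters by the missing
  letter \<open>e\<^sub>i\<close>, at the cost of a sign and of a change of the power of 3 in front
  (\<open>exchange_in_aug_power\<close>). The four pairs form a cycle \<open>3 - 1 - 0 - 2 - 3\<close>. Going once around it
  performs four replacements, and turns \<open>3\<^bsup>9\<^esup> e\<^sub>2 e\<^sub>1 e\<^sub>0\<close> into \<open>3\<^bsup>9\<^esup> e\<^sub>0 e\<^sub>2 e\<^sub>1\<close>, a cyclic rotation of the
  word, with sign \<open>+1\<close>. As \<open>[[e\<^sub>2, e\<^sub>1], e\<^sub>0]\<close> is the difference of a word and its rotation minus
  another such difference, \<open>\<omega>\<close> is in that power (\<open>omega_in_dim_subring\<close>).

  \<^emph>\<open>The multiple \<open>3\<omega>\<close>.\<close> Now \<open>3\<^bsup>10\<^esup> e\<^sub>0\<close> is available, which can be traded for \<open>3\<^bsup>12\<^esup> e\<^sub>2\<close> by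
  \<open>X\<^sub>0\<^sub>2\<close>. The error terms have weight 7, and \<open>[[e\<^sub>2, e\<^sub>1], e\<^sub>2]\<close> is dealt with in the same way until
  \<open>[[e\<^sub>2, e\<^sub>2], e\<^sub>2] = 0\<close> is left (\<open>three_omega_in_lower_central\<close>).

  \<^emph>\<open>Non-membership in the lower central series.\<close> One needs a Lie ring that satisfies the relations,
  at least modulo elements of weight 7, and in which \<open>\<omega>\<close> survives. It is built in two steps. The first
  is a Lie ring of class 3 in degrees 1, 2, 3, spanned in degree 1 by \<open>e\<^sub>i\<close> and by elements
  \<open>\<zeta>\<^sub>i\<^sub>j\<close> that play the role of \<open>y\<^sub>i\<^sub>j / 2\<close>, with a trilinear form modulo \<open>3\<^bsup>15\<^esup>\<close> that gives the value of
  a triple bracket. Each degree 1 element has a weight, namely 1 for \<open>e\<^sub>i\<close>, 2 for \<open>9\<^bsup>i\<^esup> e\<^sub>i\<close>, 3 for \<open>\<zeta>\<^sub>i\<^sub>j\<close>, and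
  infinity for the relations \<open>X\<^sub>i\<^sub>j - 2 \<cdot> 3\<^bsup>12-2i-2j\<^esup> \<zeta>\<^sub>i\<^sub>j\<close>. The form is chosen to vanish whenever the weights
  of its arguments add up to at least 7 (\<open>vanishes_weight_7\<close>), but not at
  \<open>3\<^bsup>9\<^esup> [[e\<^sub>2, e\<^sub>1], e\<^sub>0]\<close>.

  In that Lie ring the elements of weight 2 and 3 need not be commutators. The second step repairs
  this: one passes to polynomials in a variable \<open>t\<close> and adjoins the derivation \<open>D = d/dt\<close>, which has
  weight 1. An element \<open>z t\<^sup>n\<close> gets the weight of \<open>z\<close> minus \<open>n\<close>, so that \<open>D\<close> raises weights by 1. Then
  \<open>[D, z t] = z\<close> and \<open>[[z t\<^sup>2, D], D] = 2 z\<close> express elements of weight 2 and 3 as commutators of elements of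
  weight 1. The weight filtration of this bigger ring is compatible with brackets
  (\<open>filtration_bracket\<close>), so it bounds the image of the lower central series, and \<open>\<omega>\<close> is not in its
  seventh term.
\<close>

section \<open>Lie rings and the lower central series\<close>

lemma nmult_add_left: "nmult (m + n) x = nmult m x + nmult n x" for x :: "'a::ab_group_add"
  by (induction m) (simp_all add: add.assoc)

lemma nmult_mult: "nmult (m * n) x = nmult m (nmult n x)" for x :: "'a::ab_group_add"
  by (induction m) (simp_all add: nmult_add_left)

lemma nmult_zero_right [simp]: "nmult n 0 = (0 :: 'a::ab_group_add)"
  by (induction n) simp_all

lemma lie_zero_left [simp]: "\<langle>0, y\<rangle> = 0" and lie_zero_right [simp]: "\<langle>x, 0\<rangle> = 0"
  for x y :: "'a::lie_ring"
  using lie_add_left[of 0 0 y] lie_add_right[of x 0 0] by simp_all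

lemma lie_diff_left: "\<langle>x - y, z\<rangle> = \<langle>x, z\<rangle> - \<langle>y, z\<rangle>"
  and lie_diff_right: "\<langle>x, y - z\<rangle> = \<langle>x, y\<rangle> - \<langle>x, z\<rangle>" for x y z :: "'a::lie_ring"
  using lie_add_left[of "x - y" y z] lie_add_right[of x "y - z" z] by simp_all

lemma lie_swap: "\<langle>x, y\<rangle> = - \<langle>y, x\<rangle>" for x y :: "'a::lie_ring"
proof -
  have "\<langle>x + y, x + y\<rangle> = \<langle>x, y\<rangle> + \<langle>y, x\<rangle>"
    unfolding lie_add_left lie_add_right by (simp add: lie_self)
  then show ?thesis by (simp only: lie_self eq_neg_iff_add_eq_0)
qed

lemma lie_nmult_left: "\<langle>nmult n x, y\<rangle> = nmult n \<langle>x, y\<rangle>"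
  and lie_nmult_right: "\<langle>x, nmult n y\<rangle> = nmult n \<langle>x, y\<rangle>" for x y :: "'a::lie_ring"
  by (induction n) (simp_all add: lie_add_left lie_add_right)

lemma lie_bracket_of_bracket: "\<langle>x, \<langle>u, v\<rangle>\<rangle> = \<langle>\<langle>x, u\<rangle>, v\<rangle> - \<langle>\<langle>x, v\<rangle>, u\<rangle>"
  for x u v :: "'a::lie_ring"
proof -
  have "\<langle>\<langle>v, x\<rangle>, u\<rangle> = - \<langle>\<langle>x, v\<rangle>, u\<rangle>"
    using lie_diff_left[of 0 "\<langle>x, v\<rangle>" u] lie_swap[of v x] by simp
  then show ?thesis
    using lie_jacobi[of x u v] lie_swap[of "\<langle>u, v\<rangle>" x] by (simp add: algebra_simps)
qed

lemma lower_central_zero: "0 \<in> lower_central n"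
  and lower_central_diff: "x \<in> lower_central n \<Longrightarrow> y \<in> lower_central n \<Longrightarrow> x - y \<in> lower_central n"
  by (cases n rule: lower_central.cases; simp add: group_closure.diff)+

lemma lower_central_add: "x \<in> lower_central n \<Longrightarrow> y \<in> lower_central n \<Longrightarrow> x + y \<in> lower_central n"
  using lower_central_diff[of x n "0 - y"] lower_central_diff[OF lower_central_zero, of y n] by simp

lemma lower_central_nmult: "x \<in> lower_central n \<Longrightarrow> nmult k x \<in> lower_central n"
  by (induction k) (simp_all add: lower_central_zero lower_central_add)

text \<open>
  The induction on the second weight works because, by the Jacobi identity, a bracket with
  \<open>[u, v]\<close> is a combination of iterated brackets with \<open>u\<close> and \<open>v\<close>.
\<close>

lemma lower_central_bracket:
  assumes "x \<in> lower_central (Suc i)" "y \<in> lower_central (Suc j)"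
  shows "\<langle>x, y\<rangle> \<in> lower_central (Suc (Suc (i + j)))"
  using assms
proof (induction j arbitrary: i x y)
  case 0
  then show ?case by (auto intro!: group_closure.base)
next
  case (Suc j)
  from Suc.prems(2) have "y \<in> group_closure {\<langle>u, v\<rangle> | u v. u \<in> lower_central (Suc j)}" by simp
  then show ?case
  proof induction
    case (base y)
    show ?case
    proof (cases "y = 0")
      case False
      with base obtain u v where y: "y = \<langle>u, v\<rangle>" "u \<in> lower_central (Suc j)" by auto
      have "\<langle>x, u\<rangle> \<in> lower_central (Suc (Suc (i + j)))"
        by (rule Suc.IH[OF Suc.prems(1) y(2)])
      then have "\<langle>\<langle>x, u\<rangle>, v\<rangle> \<in> lower_central (Suc (Suc (Suc (i + j))))"
        by (auto simp del: lower_central.simps(3) simp: lower_central.simps(3)[of "Suc (i + j)"]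
          intro!: group_closure.base)
      moreover have "\<langle>x, v\<rangle> \<in> lower_central (Suc (Suc i))"
        using Suc.prems(1) by (auto intro!: group_closure.base)
      then have "\<langle>\<langle>x, v\<rangle>, u\<rangle> \<in> lower_central (Suc (Suc (Suc (i + j))))"
        using Suc.IH[OF _ y(2), of "\<langle>x, v\<rangle>" "Suc i"] by simp
      ultimately show ?thesis
        unfolding y(1) lie_bracket_of_bracket by (simp only: lower_central_diff add_Suc_right)
    qed (simp add: lower_central_zero del: lower_central.simps)
  qed (simp only: lie_diff_right lower_central_diff)
qed

section \<open>The multiple \<open>3\<omega>\<close> lies in the lower central series\<close>

definition rel_y :: "nat \<Rightarrow> lie_A" where
  "rel_y i = \<langle>A_gen (Abs_gen (GA i)), A_gen (Abs_gen (GB i))\<rangle>"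

definition rel_yy :: "nat \<Rightarrow> nat \<Rightarrow> lie_A" where
  "rel_yy i j = \<langle>\<langle>A_gen (Abs_gen (GU i j)), A_gen (Abs_gen (GV i j))\<rangle>, A_gen (Abs_gen (GW i j))\<rangle>"

lemma e_relation:
  assumes "i \<le> 3"
  shows "nmult (3 ^ (2 * i)) (e i) = rel_y i"
proof -
  have "i \<in> {0, 1, 2, 3}" using assms by auto
  then have "(nmult (3 ^ (2 * i)) (lgen (GE i)), y_term i) \<in> A_rels"
    unfolding A_rels_def by blast
  from A_relations[OF this] show ?thesis by (simp add: y_term_def rel_y_def e_def)
qed

lemma ee_relation:
  assumes "(i, j) \<in> {(0, 1), (0, 2), (1, 3), (2, 3)}"
  shows "nmult (3 ^ (12 - i)) (e j) + nmult (3 ^ (12 - j)) (e i) = nmult (3 ^ (12 - 2 * i - 2 * j)) (rel_yy i j)"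
proof -
  have "(nmult (3 ^ (12 - i)) (lgen (GE j)) + nmult (3 ^ (12 - j)) (lgen (GE i)),
      nmult (3 ^ (12 - 2 * i - 2 * j)) (yy_term i j)) \<in> A_rels"
    unfolding A_rels_def using assms by blast
  from A_relations[OF this] show ?thesis by (simp add: yy_term_def rel_yy_def e_def)
qed

lemma rel_y_in_lower_central: "rel_y i \<in> lower_central 2"
  unfolding rel_y_def using lower_central_bracket[of _ 0 _ 0] by (simp add: eval_nat_numeral)

lemma rel_yy_in_lower_central: "rel_yy i j \<in> lower_central 3"
  unfolding rel_yy_def using lower_central_bracket[OF lower_central_bracket[of _ 0 _ 0], of _ _ _ 0]
  by (simp add: eval_nat_numeral)

lemma triple_bracket_in_lower_central_7:
  assumes "x \<in> lower_central (Suc i)" "x' \<in> lower_central (Suc j)" "x'' \<in> lower_central (Suc k)" "i + j + k = 4"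
  shows "\<langle>\<langle>x, x'\<rangle>, x''\<rangle> \<in> lower_central 7"
proof -
  have "\<langle>\<langle>x, x'\<rangle>, x''\<rangle> \<in> lower_central (Suc (Suc (Suc (i + j) + k)))"
    by (intro lower_central_bracket assms)
  moreover have "Suc (Suc (Suc (i + j) + k)) = 7" using assms(4) by simp
  ultimately show ?thesis by metis
qed

text \<open>
  The powers of 3 in front of a triple bracket are distributed over its entries: \<open>3\<^sup>4\<close> turns \<open>e\<^sub>2\<close> into
  \<open>y\<^sub>2\<close>, and \<open>3\<^sup>2\<close> turns \<open>e\<^sub>1\<close> into \<open>y\<^sub>1\<close>. A bracket that contains one \<open>y\<^sub>i\<^sub>j\<close> then has weight 7 once
  its other two entries have been turned into \<open>y\<close>'s.
\<close>

lemma three_omega_in_lower_central: "nmult 3 (nmult (3 ^ 9) \<langle>\<langle>e 2, e 1\<rangle>, e 0\<rangle>) \<in> lower_central 7"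
proof -
  have y': "rel_y i \<in> lower_central (Suc 1)" and yy': "rel_yy i j \<in> lower_central (Suc 2)" for i j
    using rel_y_in_lower_central rel_yy_in_lower_central by (simp_all add: eval_nat_numeral)
  have e1: "nmult (3 ^ 2) (e 1) = rel_y 1" and e2: "nmult (3 ^ 4) (e 2) = rel_y 2"
    using e_relation[of 1] e_relation[of 2] by simp_all
  have e01: "nmult (3 ^ 12) (e 1) = nmult (3 ^ 10) (rel_yy 0 1) - nmult (3 ^ 11) (e 0)"
    using ee_relation[of 0 1] by (simp add: eq_diff_eq)
  have e02: "nmult (3 ^ 10) (e 0) = nmult (3 ^ 8) (rel_yy 0 2) - nmult (3 ^ 12) (e 2)"
    using ee_relation[of 0 2] by (simp add: eq_diff_eq add.commute)
  have "\<langle>\<langle>rel_y 2, rel_y 1\<rangle>, rel_yy 0 2\<rangle> \<in> lower_central 7" "\<langle>\<langle>rel_y 2, rel_yy 0 1\<rangle>, rel_y 2\<rangle> \<in> lower_central 7"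
    "\<langle>\<langle>rel_y 2, rel_yy 0 2\<rangle>, rel_y 2\<rangle> \<in> lower_central 7"
    by (rule triple_bracket_in_lower_central_7[OF y' y' yy'] triple_bracket_in_lower_central_7[OF y' yy' y'];
      simp)+
  then have "nmult 9 \<langle>\<langle>rel_y 2, rel_y 1\<rangle>, rel_yy 0 2\<rangle> - (nmult 9 \<langle>\<langle>rel_y 2, rel_yy 0 1\<rangle>, rel_y 2\<rangle> - nmult 3 \<langle>\<langle>rel_y 2, rel_yy 0 2\<rangle>, rel_y 2\<rangle>)
      \<in> lower_central 7"
    by (intro lower_central_diff lower_central_nmult)
  moreover have "nmult (3 ^ 11) \<langle>\<langle>e 2, e 0\<rangle>, e 2\<rangle> = nmult 3 \<langle>\<langle>rel_y 2, rel_yy 0 2\<rangle>, rel_y 2\<rangle>"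
  proof -
    have "nmult (3 ^ 11) \<langle>\<langle>e 2, e 0\<rangle>, e 2\<rangle> = nmult 3 \<langle>\<langle>e 2, nmult (3 ^ 10) (e 0)\<rangle>, e 2\<rangle>"
      by (simp add: lie_nmult_left lie_nmult_right flip: nmult_mult)
    also have "\<dots> = nmult 3 \<langle>\<langle>nmult (3 ^ 4) (e 2), rel_yy 0 2\<rangle>, nmult (3 ^ 4) (e 2)\<rangle>"
      unfolding e02 by (simp add: lie_diff_left lie_diff_right lie_nmult_left lie_nmult_right lie_self flip: nmult_mult)
    finally show ?thesis unfolding e2 .
  qed
  moreover have "nmult (3 ^ 12) \<langle>\<langle>e 2, e 1\<rangle>, e 2\<rangle> = nmult 9 \<langle>\<langle>rel_y 2, rel_yy 0 1\<rangle>, rel_y 2\<rangle> - nmult (3 ^ 11) \<langle>\<langle>e 2, e 0\<rangle>, e 2\<rangle>"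
  proof -
    have "nmult (3 ^ 12) \<langle>\<langle>e 2, e 1\<rangle>, e 2\<rangle> = \<langle>\<langle>e 2, nmult (3 ^ 12) (e 1)\<rangle>, e 2\<rangle>"
      by (simp add: lie_nmult_left lie_nmult_right)
    also have "\<dots> = nmult 9 \<langle>\<langle>nmult (3 ^ 4) (e 2), rel_yy 0 1\<rangle>, nmult (3 ^ 4) (e 2)\<rangle>
        - nmult (3 ^ 11) \<langle>\<langle>e 2, e 0\<rangle>, e 2\<rangle>"
      unfolding e01 by (simp add: lie_diff_left lie_diff_right lie_nmult_left lie_nmult_right flip: nmult_mult)
    finally show ?thesis unfolding e2 .
  qed
  moreover have "nmult 3 (nmult (3 ^ 9) \<langle>\<langle>e 2, e 1\<rangle>, e 0\<rangle>) =
      nmult 9 \<langle>\<langle>rel_y 2, rel_y 1\<rangle>, rel_yy 0 2\<rangle> - nmult (3 ^ 12) \<langle>\<langle>e 2, e 1\<rangle>, e 2\<rangle>"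
  proof -
    have "nmult 3 (nmult (3 ^ 9) \<langle>\<langle>e 2, e 1\<rangle>, e 0\<rangle>) = \<langle>\<langle>e 2, e 1\<rangle>, nmult (3 ^ 10) (e 0)\<rangle>"
      by (simp add: lie_nmult_right flip: nmult_mult)
    also have "\<dots> = nmult 9 \<langle>\<langle>nmult (3 ^ 4) (e 2), nmult (3 ^ 2) (e 1)\<rangle>, rel_yy 0 2\<rangle>
        - nmult (3 ^ 12) \<langle>\<langle>e 2, e 1\<rangle>, e 2\<rangle>"
      unfolding e02 by (simp add: lie_diff_right lie_nmult_left lie_nmult_right flip: nmult_mult)
    finally show ?thesis unfolding e1 e2 .
  qed
  ultimately show ?thesis by simp
qed

section \<open>\<open>\<omega>\<close> lies in the dimension subring\<close>

lemma ideal_power_diff: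
  "x \<in> ideal_power I n \<Longrightarrow> y \<in> ideal_power I n \<Longrightarrow> x - y \<in> ideal_power I n"
  by (cases n) (simp_all add: group_closure.diff)

lemma ideal_power_zero: "0 \<in> ideal_power I n"
  by (cases n) simp_all

lemma ideal_power_add:
  "x \<in> ideal_power I n \<Longrightarrow> y \<in> ideal_power I n \<Longrightarrow> x + y \<in> ideal_power I n"
  using ideal_power_diff[of x I n "0 - y"] ideal_power_diff[OF ideal_power_zero, of y I n] by simp

lemma ideal_power_mult:
  assumes I: "\<And>x u. x \<in> I \<Longrightarrow> x * u \<in> I"
    and "x \<in> ideal_power I m" "y \<in> ideal_power I n"
  shows "x * y \<in> ideal_power I (m + n)"
  using assms(3)
proof (induction n arbitrary: y)
  case 0
  show ?case
  proof (cases m)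
    case (Suc k)
    with assms(2) have "x \<in> group_closure {u * v | u v. u \<in> ideal_power I k \<and> v \<in> I}" by simp
    then have "x * y \<in> group_closure {u * v | u v. u \<in> ideal_power I k \<and> v \<in> I}"
    proof induction
      case (base x)
      then consider "x = 0" | u v where "x = u * v" "u \<in> ideal_power I k" "v \<in> I" by auto
      then show ?case
        by cases (auto simp: mult.assoc intro!: group_closure.base I)
    qed (simp add: left_diff_distrib group_closure.diff)
    with Suc show ?thesis by simp
  qed simp
next
  case (Suc n)
  from Suc.prems have "y \<in> group_closure {u * v | u v. u \<in> ideal_power I n \<and> v \<in> I}" by simp
  then show ?case
  proof induction
    case (base y)
    then consider "y = 0" | u v where "y = u * v" "u \<in> ideal_power I n" "v \<in> I" by auto
    then show ?case
      by cases (use Suc.IH in \<open>auto simp: mult.assoc[symmetric] intro!: group_closure.base\<close>)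
  qed (simp add: right_diff_distrib group_closure.diff)
qed

lemma uea_aug_mult: "uea_aug (u * v) = uea_aug u * uea_aug v"
  by transfer simp

lemma uea_aug_incl: "uea_aug (uea_incl x) = 0"
  by transfer simp

lemma aug_ideal_mult: "u \<in> aug_ideal \<Longrightarrow> u * v \<in> aug_ideal"
  by (simp add: aug_ideal_def uea_aug_mult)

abbreviation aug_power :: "nat \<Rightarrow> 'a::lie_ring uea set" where
  "aug_power n \<equiv> ideal_power aug_ideal n"

lemmas aug_power_mult = ideal_power_mult[where I = aug_ideal, OF aug_ideal_mult]

lemma uea_incl_in_aug_power: "uea_incl x \<in> aug_power 1"
proof -
  have "uea_incl x \<in> aug_ideal" by (simp add: aug_ideal_def uea_aug_incl)
  then have "uea_incl x \<in> {u * v | u v. u \<in> aug_power 0 \<and> v \<in> aug_ideal}"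
    by (auto intro: exI[of _ 1])
  then show ?thesis by (simp add: group_closure.base)
qed

lemma dim_subring_bracket:
  assumes "x \<in> dim_subring m" "y \<in> dim_subring n"
  shows "\<langle>x, y\<rangle> \<in> dim_subring (m + n)"
  using aug_power_mult[of "uea_incl x" m "uea_incl y" n] aug_power_mult[of "uea_incl y" n "uea_incl x" m] assms
  unfolding dim_subring_def by (simp add: uea_incl_lie ideal_power_diff add.commute)

lemma dim_subring_1: "x \<in> dim_subring 1"
  using uea_incl_in_aug_power unfolding dim_subring_def by simp

lemma uea_incl_nmult: "uea_incl (nmult n x) = of_nat n * uea_incl x"
proof (induction n)
  case 0
  show ?case using uea_incl_add[of 0 0] by simp
qed (simp add: uea_incl_add algebra_simps)

lemma rel_y_in_dim_subring: "rel_y i \<in> dim_subring 2"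
  unfolding rel_y_def one_add_one[symmetric] by (intro dim_subring_bracket dim_subring_1)

lemma rel_yy_in_dim_subring: "rel_yy i j \<in> dim_subring 3"
proof -
  have "rel_yy i j \<in> dim_subring (1 + 1 + 1)"
    unfolding rel_yy_def by (intro dim_subring_bracket dim_subring_1)
  then show ?thesis by (simp add: numeral_3_eq_3)
qed

abbreviation E :: "nat \<Rightarrow> lie_A uea" where
  "E i \<equiv> uea_incl (e i)"

lemma scaled_E_in_aug_power: "i \<le> 3 \<Longrightarrow> 9 ^ i * E i \<in> aug_power 2"
  using rel_y_in_dim_subring[of i] uea_incl_nmult[of "3 ^ (2 * i)" "e i"] e_relation[of i]
  unfolding dim_subring_def by (simp add: power_mult)

lemma numeral_power_commute: "x * numeral k ^ n = numeral k ^ n * (x :: 'a::ring_1)"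
  by (metis mult_of_nat_commute of_nat_numeral of_nat_power)

text \<open>
  Modulo the seventh power of the augmentation ideal, \<open>3\<^bsup>12-i\<^esup> e\<^sub>j\<close> can be exchanged for \<open>-3\<^bsup>12-j\<^esup> e\<^sub>i\<close> at any
  position of a word whose other letters are \<open>e\<^sub>k\<close> and \<open>e\<^sub>l\<close>. The reason is that
  \<open>12 - 2i - 2j = 2k + 2l\<close>: the factor \<open>9\<^bsup>k\<^esup> 9\<^bsup>l\<^esup>\<close> in front of \<open>y\<^sub>i\<^sub>j\<close> moves over to \<open>e\<^sub>k\<close> and \<open>e\<^sub>l\<close>, and puts
  each of them into the second power.
\<close>

lemma exchange_in_aug_power:
  assumes "(i, j) \<in> {(0, 1), (0, 2), (1, 3), (2, 3)}" "i + j + k + l = 6" "k \<le> 3" "l \<le> 3"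
  shows "3 ^ (12 - i) * (E j * E k * E l) + 3 ^ (12 - j) * (E i * E k * E l) \<in> aug_power 7"
    and "3 ^ (12 - i) * (E k * E j * E l) + 3 ^ (12 - j) * (E k * E i * E l) \<in> aug_power 7"
    and "3 ^ (12 - i) * (E k * E l * E j) + 3 ^ (12 - j) * (E k * E l * E i) \<in> aug_power 7"
proof -
  define Z where "Z = uea_incl (rel_yy i j)"
  have Z: "Z \<in> aug_power 3"
    using rel_yy_in_dim_subring[of i j] by (simp add: Z_def dim_subring_def)
  have "12 - 2 * i - 2 * j = 2 * k + 2 * l" using assms(2) by linarith
  then have "(3::lie_A uea) ^ (12 - 2 * i - 2 * j) = 9 ^ k * 9 ^ l"
    by (simp add: power_add power_mult)
  then have X: "3 ^ (12 - i) * E j + 3 ^ (12 - j) * E i = 9 ^ k * 9 ^ l * Z"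
    using arg_cong[OF ee_relation[OF assms(1)], of uea_incl]
    by (simp add: uea_incl_add uea_incl_nmult Z_def)
  have k: "9 ^ k * E k \<in> aug_power 2" and l: "9 ^ l * E l \<in> aug_power 2"
    using assms(3,4) by (simp_all add: scaled_E_in_aug_power)
  have c: "x * (numeral a ^ n * z) = numeral a ^ n * (x * z)" for x z :: "lie_A uea" and n a
    by (simp only: mult.assoc[symmetric] numeral_power_commute[of x])
  have "Z * (9 ^ k * E k) * (9 ^ l * E l) \<in> aug_power (3 + 2 + 2)"
    by (intro aug_power_mult Z k l)
  moreover have "Z * (9 ^ k * E k) * (9 ^ l * E l) = (3 ^ (12 - i) * E j + 3 ^ (12 - j) * E i) * E k * E l"
    unfolding X by (simp add: mult.assoc c[of "E _"] c[of Z])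
  ultimately show "3 ^ (12 - i) * (E j * E k * E l) + 3 ^ (12 - j) * (E i * E k * E l) \<in> aug_power 7"
    by (simp add: distrib_right mult.assoc)
  have "(9 ^ k * E k) * Z * (9 ^ l * E l) \<in> aug_power (2 + 3 + 2)"
    by (intro aug_power_mult Z k l)
  moreover have "(9 ^ k * E k) * Z * (9 ^ l * E l) = E k * (3 ^ (12 - i) * E j + 3 ^ (12 - j) * E i) * E l"
    unfolding X by (simp add: mult.assoc c[of "E _"] c[of Z])
  ultimately show "3 ^ (12 - i) * (E k * E j * E l) + 3 ^ (12 - j) * (E k * E i * E l) \<in> aug_power 7"
    by (simp add: distrib_right distrib_left mult.assoc c[of "E _"])
  have "(9 ^ k * E k) * (9 ^ l * E l) * Z \<in> aug_power (2 + 2 + 3)"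
    by (intro aug_power_mult Z k l)
  moreover have "(9 ^ k * E k) * (9 ^ l * E l) * Z = E k * E l * (3 ^ (12 - i) * E j + 3 ^ (12 - j) * E i)"
    unfolding X by (simp add: mult.assoc c[of "E _"] c[of Z])
  ultimately show "3 ^ (12 - i) * (E k * E l * E j) + 3 ^ (12 - j) * (E k * E l * E i) \<in> aug_power 7"
    by (simp add: distrib_right distrib_left mult.assoc c[of "E _"])
qed

lemma omega_in_dim_subring: "nmult (3 ^ 9) \<langle>\<langle>e 2, e 1\<rangle>, e 0\<rangle> \<in> dim_subring 7"
proof -
  have alternate: "a - e \<in> aug_power 7"
    if "a + b \<in> aug_power 7" "b + c \<in> aug_power 7" "c + d \<in> aug_power 7" "d + e \<in> aug_power 7"
    for a b c d e :: "lie_A uea"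
    using ideal_power_add[OF ideal_power_diff[OF that(1,2)] ideal_power_diff[OF that(3,4)]]
    by (simp add: algebra_simps)
  \<comment> \<open>once around the cycle \<open>3 - 1 - 0 - 2 - 3\<close>: the missing letter is 3, 1, 0, 2 and again 3\<close>
  have "3 ^ 9 * (E 2 * E 1 * E 0) - 3 ^ 9 * (E 0 * E 2 * E 1) \<in> aug_power 7"
  proof (rule alternate)
    show "3 ^ 9 * (E 2 * E 1 * E 0) + 3 ^ 11 * (E 2 * E 3 * E 0) \<in> aug_power 7"
      using exchange_in_aug_power(2)[of 1 3 2 0] by (simp add: add.commute)
    show "3 ^ 11 * (E 2 * E 3 * E 0) + 3 ^ 12 * (E 2 * E 3 * E 1) \<in> aug_power 7"
      using exchange_in_aug_power(3)[of 0 1 2 3] by (simp add: add.commute)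
    show "3 ^ 12 * (E 2 * E 3 * E 1) + 3 ^ 10 * (E 0 * E 3 * E 1) \<in> aug_power 7"
      using exchange_in_aug_power(1)[of 0 2 3 1] by simp
    show "3 ^ 10 * (E 0 * E 3 * E 1) + 3 ^ 9 * (E 0 * E 2 * E 1) \<in> aug_power 7"
      using exchange_in_aug_power(2)[of 2 3 0 1] by simp
  qed
  \<comment> \<open>the same cycle in the opposite direction\<close>
  moreover have "3 ^ 9 * (E 1 * E 2 * E 0) - 3 ^ 9 * (E 0 * E 1 * E 2) \<in> aug_power 7"
  proof (rule alternate)
    show "3 ^ 9 * (E 1 * E 2 * E 0) + 3 ^ 10 * (E 1 * E 3 * E 0) \<in> aug_power 7"
      using exchange_in_aug_power(2)[of 2 3 1 0] by (simp add: add.commute)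
    show "3 ^ 10 * (E 1 * E 3 * E 0) + 3 ^ 12 * (E 1 * E 3 * E 2) \<in> aug_power 7"
      using exchange_in_aug_power(3)[of 0 2 1 3] by (simp add: add.commute)
    show "3 ^ 12 * (E 1 * E 3 * E 2) + 3 ^ 11 * (E 0 * E 3 * E 2) \<in> aug_power 7"
      using exchange_in_aug_power(1)[of 0 1 3 2] by simp
    show "3 ^ 11 * (E 0 * E 3 * E 2) + 3 ^ 9 * (E 0 * E 1 * E 2) \<in> aug_power 7"
      using exchange_in_aug_power(2)[of 1 3 0 2] by simp
  qed
  ultimately have "3 ^ 9 * (E 2 * E 1 * E 0) - 3 ^ 9 * (E 0 * E 2 * E 1)
      - (3 ^ 9 * (E 1 * E 2 * E 0) - 3 ^ 9 * (E 0 * E 1 * E 2)) \<in> aug_power 7"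
    by (rule ideal_power_diff)
  then show ?thesis
    by (simp add: dim_subring_def uea_incl_nmult uea_incl_lie algebra_simps)
qed

section \<open>A trilinear form that detects \<open>\<omega>\<close>\<close>

text \<open>
  Put \<open>f\<^sub>i = 3\<^bsup>i\<^esup> e\<^sub>i\<close>, so that \<open>X\<^sub>i\<^sub>j = 3\<^bsup>12-i-j\<^esup> (f\<^sub>i + f\<^sub>j)\<close>. The function below is a linear functional on words
  of length 3 in the letters \<open>f\<^sub>0, \<dots>, f\<^sub>3\<close>, and only its values \<open>\<chi>\<close> on brackets matter. For each
  \<open>a < b < c\<close> it takes opposite values \<open>\<plusminus>1\<close> on the words \<open>abc\<close> and \<open>bca\<close>. Then \<open>\<chi>\<close> has the values
  \<open>\<plusminus>(1, -2, 1)\<close> on \<open>[[a, b], c]\<close>, \<open>[[b, c], a]\<close>, \<open>[[c, a], b]\<close>, so it is alternating modulo 3 although it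
  satisfies the Jacobi identity over the integers. The signs of the four triples are such that
  \<open>\<chi>(f\<^sub>i + f\<^sub>j, f\<^sub>k, f\<^sub>l)\<close> is divisible by 3 when \<open>ij\<close> is one of the four pairs and \<open>k\<close>, \<open>l\<close> are the other
  two indices. The words \<open>322\<close> and \<open>233\<close> achieve in addition that \<open>\<chi>(f\<^sub>0 + f\<^sub>2, f\<^sub>2 + f\<^sub>3, f\<^sub>3)\<close> and
  \<open>\<chi>(f\<^sub>0 + f\<^sub>2, f\<^sub>3, f\<^sub>2 + f\<^sub>3)\<close> are divisible by 3, as needed for the relation of the pair \<open>23\<close> in the presence
  of \<open>\<zeta>\<^sub>0\<^sub>2\<close>.
\<close>

definition word_coeff :: "nat \<Rightarrow> nat \<Rightarrow> nat \<Rightarrow> int" where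
  "word_coeff i j k =
     (if (i, j, k) \<in> {(0, 1, 2), (0, 2, 3), (1, 3, 0), (2, 3, 1), (3, 2, 2)} then 1
      else if (i, j, k) \<in> {(1, 2, 0), (2, 3, 0), (0, 1, 3), (1, 2, 3), (2, 3, 3)} then - 1
      else 0)"

text \<open>
  The value of a functional \<open>t\<close> on \<open>[[i, j], k] = ijk - jik - kij + kji\<close>.
\<close>

definition on_bracket :: "(nat \<Rightarrow> nat \<Rightarrow> nat \<Rightarrow> int) \<Rightarrow> nat \<Rightarrow> nat \<Rightarrow> nat \<Rightarrow> int" where
  "on_bracket t i j k = t i j k - t j i k - t k i j + t k j i"

text \<open>
  Vectors have eight coordinates: 0 to 3 belong to \<open>e\<^sub>0, \<dots>, e\<^sub>3\<close>, and 4 to 7 to \<open>\<zeta>\<^sub>0\<^sub>1\<close>, \<open>\<zeta>\<^sub>0\<^sub>2\<close>, \<open>\<zeta>\<^sub>1\<^sub>3\<close>, \<open>\<zeta>\<^sub>2\<^sub>3\<close>.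
\<close>

definition zeta_pair :: "nat \<Rightarrow> nat \<times> nat" where
  "zeta_pair p =
     (if p = 4 then (0, 1) else if p = 5 then (0, 2) else if p = 6 then (1, 3) else (2, 3))"

text \<open>
  This is again a functional on words, now in the eight basis vectors. Its value on a triple bracket
  is to be read modulo \<open>3\<^bsup>15\<^esup>\<close>. On brackets of \<open>e\<close>'s it is twice \<open>\<chi>\<close>, rescaled by \<open>f\<^sub>i = 3\<^bsup>i\<^esup> e\<^sub>i\<close>;
  the exponent \<open>8 - p - q - r\<close> is not truncated where the coefficient is nonzero. As
  \<open>X\<^sub>i\<^sub>j = 2 \<cdot> 3\<^bsup>12-2i-2j\<^esup> \<zeta>\<^sub>i\<^sub>j\<close> should hold, the value on \<open>[[\<zeta>\<^sub>i\<^sub>j, e\<^sub>k], e\<^sub>l]\<close> is expected to be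
  \<open>v = 3\<^bsup>8+i+j-k-l\<^esup> \<chi>(f\<^sub>i + f\<^sub>j, f\<^sub>k, f\<^sub>l)\<close>. On the other hand \<open>9\<^bsup>k+l\<^esup>\<close> times that value must vanish, because
  \<open>[[\<zeta>\<^sub>i\<^sub>j, 9\<^bsup>k\<^esup> e\<^sub>k], 9\<^bsup>l\<^esup> e\<^sub>l]\<close> has weight 7. The choice \<open>v\<close> does this if \<open>i + j + k + l \<ge> 7\<close>. Otherwise the value
  is taken to be 0. The relation is not violated by that: if \<open>i + j + k + l \<le> 5\<close>, then
  \<open>2 \<cdot> 3\<^bsup>12-2i-2j\<^esup> v\<close> vanishes anyway, and if the sum is 6, it vanishes because 3 divides \<open>\<chi>(f\<^sub>i + f\<^sub>j, f\<^sub>k, f\<^sub>l)\<close>.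

  A letter \<open>\<zeta>\<close> is allowed only in the first place of a word, since the values on \<open>[[\<zeta>, x], y]\<close> can be
  prescribed freely and determine the values on all other brackets of \<open>\<zeta>\<close>, \<open>x\<close>, \<open>y\<close>.
\<close>

definition form_coeff :: "nat \<Rightarrow> nat \<Rightarrow> nat \<Rightarrow> int" where
  "form_coeff p q r =
     (if q > 3 \<or> r > 3 then 0
      else if p \<le> 3 then 2 * 3 ^ (8 - p - q - r) * word_coeff p q r
      else let (i, j) = zeta_pair p in
        if i + j + q + r < 7 then 0
        else 3 ^ (8 + i + j - q - r) * (on_bracket word_coeff i q r + on_bracket word_coeff j q r))"

text \<open>
  The coordinates of \<open>X\<^sub>i\<^sub>j - 2 \<cdot> 3\<^bsup>12-2i-2j\<^esup> \<zeta>\<^sub>i\<^sub>j\<close>. The factor 2 is the one in \<open>[[\<zeta> t\<^sup>2, D], D] = 2 \<zeta>\<close>.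
\<close>

definition relation_vec :: "nat \<Rightarrow> nat \<Rightarrow> int" where
  "relation_vec p = (let (i, j) = zeta_pair p in
    (\<lambda>q. if q = j then 3 ^ (12 - i) else if q = i then 3 ^ (12 - j)
         else if q = p then - 2 * 3 ^ (12 - 2 * i - 2 * j) else 0))"

text \<open>
  The smallest multiple of a basis vector that has weight at least 2.
\<close>

definition weight2_factor :: "nat \<Rightarrow> int" where
  "weight2_factor p = (if p < 4 then 9 ^ p else 1)"

text \<open>
  The next three facts say that the form vanishes on a relation and on arguments of weights 3, 2, 2
  and 3, 1, 3. The first two are finite computations with the table of coefficients; the third holds
  because every word with a nonzero coefficient contains \<open>\<zeta>\<close>'s at most once.
\<close>

lemma form_relation:
  assumes "4 \<le> p" "p < 8" "q < 8" "r < 8"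
  shows "3 ^ 15 dvd (\<Sum>s\<leftarrow>[0..<8]. relation_vec p s * on_bracket form_coeff s q r)"
proof -
  have "\<forall>p\<in>set [4..<8]. \<forall>q\<in>set [0..<8]. \<forall>r\<in>set [0..<8].
      3 ^ 15 dvd (\<Sum>s\<leftarrow>[0..<8]. relation_vec p s * on_bracket form_coeff s q r)"
    by code_simp
  then show ?thesis
    by (elim ballE) (use assms in \<open>auto simp only: set_upt atLeastLessThan_iff\<close>)
qed

lemma form_weight_3_2_2:
  assumes "4 \<le> p" "p < 8" "q < 8" "r < 8"
  shows "3 ^ 15 dvd weight2_factor q * weight2_factor r * on_bracket form_coeff p q r"
proof -
  have "\<forall>p\<in>set [4..<8]. \<forall>q\<in>set [0..<8]. \<forall>r\<in>set [0..<8].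
      3 ^ 15 dvd weight2_factor q * weight2_factor r * on_bracket form_coeff p q r"
    by code_simp
  then show ?thesis
    by (elim ballE) (use assms in \<open>auto simp only: set_upt atLeastLessThan_iff\<close>)
qed

lemma form_two_zetas:
  assumes "4 \<le> p" "p < 8" "q < 8" "4 \<le> r" "r < 8"
  shows "on_bracket form_coeff p q r = 0"
  using assms by (simp add: on_bracket_def form_coeff_def)

section \<open>The Lie ring of polynomials with the derivation\<close>

text \<open>
  The value of the functional on \<open>S \<otimes> z - z \<otimes> S\<close>, the commutator in the tensor ring of an element \<open>S\<close> of
  degree 2 and a vector \<open>z\<close>. The coefficient ring is left open, because the form is needed both over
  the integers and over the polynomials.
\<close>

definition pairing :: "(nat \<Rightarrow> nat \<Rightarrow> 'r::comm_ring_1) \<Rightarrow> (nat \<Rightarrow> 'r) \<Rightarrow> 'r" where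
  "pairing S z = (\<Sum>p<8. \<Sum>q<8. \<Sum>r<8. of_int (form_coeff p q r) * (S p q * z r - z p * S q r))"

definition wedge :: "(nat \<Rightarrow> 'r::comm_ring_1) \<Rightarrow> (nat \<Rightarrow> 'r) \<Rightarrow> nat \<Rightarrow> nat \<Rightarrow> 'r" where
  "wedge x y = (\<lambda>p q. x p * y q - y p * x q)"

lemma pairing_add_left: "pairing (S + S') z = pairing S z + pairing S' z"
  and pairing_diff_left: "pairing (S - S') z = pairing S z - pairing S' z"
  and pairing_add_right: "pairing S (z + z') = pairing S z + pairing S z'"
  and pairing_diff_right: "pairing S (z - z') = pairing S z - pairing S z'"
  by (simp_all add: pairing_def sum.distrib[symmetric] sum_subtractf[symmetric] algebra_simps)

lemma pairing_minus_left: "pairing (- S) z = - pairing S z"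
  and pairing_minus_right: "pairing S (- z) = - pairing S z"
  by (simp_all add: pairing_def sum_negf[symmetric] algebra_simps)

lemma pairing_zero_left [simp]: "pairing 0 z = 0"
  and pairing_zero_right [simp]: "pairing S 0 = 0"
  by (simp_all add: pairing_def)

lemma pairing_scale_left: "pairing (\<lambda>p q. c * S p q) z = c * pairing S z"
  and pairing_scale_right: "pairing S (\<lambda>p. c * z p) = c * pairing S z"
  by (simp_all add: pairing_def sum_distrib_left algebra_simps)

lemma wedge_add_left: "wedge (x + x') y = wedge x y + wedge x' y"
  and wedge_diff_left: "wedge (x - x') y = wedge x y - wedge x' y"
  and wedge_add_right: "wedge x (y + y') = wedge x y + wedge x y'"
  and wedge_diff_right: "wedge x (y - y') = wedge x y - wedge x y'"
  by (simp_all add: wedge_def fun_eq_iff algebra_simps)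

lemma wedge_zero_left [simp]: "wedge 0 y = 0"
  and wedge_zero_right [simp]: "wedge x 0 = 0"
  by (simp_all add: wedge_def fun_eq_iff)

lemma wedge_self: "wedge x x = 0"
  by (simp add: wedge_def fun_eq_iff)

lemma wedge_commute: "wedge y x = - wedge x y"
  by (simp add: wedge_def fun_eq_iff)

text \<open>
  Commutators in the tensor ring satisfy the Jacobi identity, hence so does every functional of them.
\<close>

lemma pairing_wedge_jacobi:
  "pairing (wedge x y) z + pairing (wedge y z) x + pairing (wedge z x) y = 0"
  unfolding pairing_def wedge_def sum.distrib[symmetric]
  by (intro sum.neutral ballI) (simp add: algebra_simps)

text \<open>
  An element consists of its components of degrees 1, 2, 3 over \<open>\<int>[t]\<close> and of its coefficient at
  \<open>D = d/dt\<close>. Degree 2 is the tensor square, so that brackets of vectors are formed without reference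
  to the form; it enters when degree 3 is reached, where a single coordinate suffices.
\<close>

datatype model =
  Model (deg1: "nat \<Rightarrow> int poly") (deg2: "nat \<Rightarrow> nat \<Rightarrow> int poly") (deg3: "int poly") (der: int)

definition pderiv1 :: "(nat \<Rightarrow> int poly) \<Rightarrow> nat \<Rightarrow> int poly" where
  "pderiv1 x = (\<lambda>p. pderiv (x p))"
definition pderiv2 :: "(nat \<Rightarrow> nat \<Rightarrow> int poly) \<Rightarrow> nat \<Rightarrow> nat \<Rightarrow> int poly" where
  "pderiv2 S = (\<lambda>p q. pderiv (S p q))"
definition scale1 :: "int \<Rightarrow> (nat \<Rightarrow> int poly) \<Rightarrow> nat \<Rightarrow> int poly" where
  "scale1 c x = (\<lambda>p. of_int c * x p)"
definition scale2 :: "int \<Rightarrow> (nat \<Rightarrow> nat \<Rightarrow> int poly) \<Rightarrow> nat \<Rightarrow> nat \<Rightarrow> int poly" where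
  "scale2 c S = (\<lambda>p q. of_int c * S p q)"

lemma pderiv_of_int: "pderiv (of_int c :: int poly) = 0"
  by (simp add: of_int_poly pderiv_pCons)

lemma pderiv_of_int_mult: "pderiv (of_int c * p) = of_int c * pderiv (p :: int poly)"
  by (simp add: pderiv_mult pderiv_of_int)

lemma pderiv_sum: "pderiv (sum f A) = (\<Sum>x\<in>A. pderiv (f x))"
  using higher_pderiv_sum[of 1 f A] by simp

lemma pderiv_pairing:
  "pderiv (pairing S z) = pairing (pderiv2 S) z + pairing S (pderiv1 z)"
  unfolding pairing_def pderiv1_def pderiv2_def sum.distrib[symmetric]
  by (simp add: pderiv_sum pderiv_mult pderiv_diff pderiv_of_int algebra_simps)

lemmas model_ops = pairing_add_left pairing_diff_left pairing_add_right pairing_diff_right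
  pairing_minus_left pairing_minus_right
  wedge_add_left wedge_diff_left wedge_add_right wedge_diff_right

lemma pairing_scale2: "pairing (scale2 c S) z = of_int c * pairing S z"
  by (simp add: scale2_def pairing_scale_left)
lemma pairing_scale1: "pairing S (scale1 c z) = of_int c * pairing S z"
  by (simp add: scale1_def pairing_scale_right)

instantiation model :: lie_ring
begin
definition "0 = Model 0 0 0 0"
definition "x + y = Model (deg1 x + deg1 y) (deg2 x + deg2 y) (deg3 x + deg3 y) (der x + der y)"
definition "x - y = Model (deg1 x - deg1 y) (deg2 x - deg2 y) (deg3 x - deg3 y) (der x - der y)"
definition "- x = Model (- deg1 x) (- deg2 x) (- deg3 x) (- der x)"
definition "\<langle>x, y\<rangle> = Model
  (scale1 (der x) (pderiv1 (deg1 y)) - scale1 (der y) (pderiv1 (deg1 x)))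
  (wedge (deg1 x) (deg1 y) + scale2 (der x) (pderiv2 (deg2 y)) - scale2 (der y) (pderiv2 (deg2 x)))
  (pairing (deg2 x) (deg1 y) - pairing (deg2 y) (deg1 x)
    + of_int (der x) * pderiv (deg3 y) - of_int (der y) * pderiv (deg3 x))
  0"

instance
proof
  fix x y z :: model
  show "x + y + z = x + (y + z)" "x + y = y + x" "0 + x = x" "- x + x = 0" "x - y = x + - y"
    by (simp_all add: zero_model_def plus_model_def minus_model_def uminus_model_def model.expand)
  show "\<langle>x + y, z\<rangle> = \<langle>x, z\<rangle> + \<langle>y, z\<rangle>" "\<langle>x, y + z\<rangle> = \<langle>x, y\<rangle> + \<langle>x, z\<rangle>"
    by (simp_all add: lie_model_def plus_model_def model_ops pderiv_add algebra_simps
      scale1_def scale2_def pderiv1_def pderiv2_def fun_eq_iff wedge_def)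
  show "\<langle>x, x\<rangle> = 0"
    by (simp add: lie_model_def zero_model_def wedge_self)
  have "deg1 (\<langle>\<langle>x, y\<rangle>, z\<rangle> + \<langle>\<langle>y, z\<rangle>, x\<rangle> + \<langle>\<langle>z, x\<rangle>, y\<rangle>) = 0"
    by (simp add: lie_model_def plus_model_def scale1_def pderiv1_def fun_eq_iff pderiv_diff
      pderiv_of_int_mult algebra_simps)
  moreover have "deg2 (\<langle>\<langle>x, y\<rangle>, z\<rangle> + \<langle>\<langle>y, z\<rangle>, x\<rangle> + \<langle>\<langle>z, x\<rangle>, y\<rangle>) = 0"
    by (simp add: lie_model_def plus_model_def scale1_def scale2_def pderiv1_def pderiv2_def wedge_def
      fun_eq_iff pderiv_diff pderiv_add pderiv_mult pderiv_of_int algebra_simps)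
  moreover have "deg3 (\<langle>\<langle>x, y\<rangle>, z\<rangle> + \<langle>\<langle>y, z\<rangle>, x\<rangle> + \<langle>\<langle>z, x\<rangle>, y\<rangle>) = 0"
    using pairing_wedge_jacobi[of "deg1 x" "deg1 y" "deg1 z"]
    by (simp add: lie_model_def plus_model_def model_ops pairing_scale1 pairing_scale2 pderiv_pairing
       pderiv_diff pderiv_add pderiv_of_int_mult algebra_simps)
  moreover have "der (\<langle>\<langle>x, y\<rangle>, z\<rangle> + \<langle>\<langle>y, z\<rangle>, x\<rangle> + \<langle>\<langle>z, x\<rangle>, y\<rangle>) = 0"
    by (simp add: lie_model_def plus_model_def)
  ultimately show "\<langle>\<langle>x, y\<rangle>, z\<rangle> + \<langle>\<langle>y, z\<rangle>, x\<rangle> + \<langle>\<langle>z, x\<rangle>, y\<rangle> = 0"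
    by (simp add: zero_model_def model.expand)
qed
end

section \<open>Weights of vectors\<close>

definition unit_vec :: "nat \<Rightarrow> nat \<Rightarrow> int" where
  "unit_vec p = (\<lambda>q. if q = p then 1 else 0)"

text \<open>
  Relations are put into every \<open>weight_generators k\<close> with \<open>k \<ge> 2\<close>, since they have infinite weight; they
  need not lie in the span of the \<open>\<zeta>\<close>'s. For \<open>k = 1\<close> the basis vectors generate them.
\<close>

definition weight_generators :: "nat \<Rightarrow> (nat \<Rightarrow> int) set" where
  "weight_generators k =
     (if k \<le> 1 then unit_vec ` {..<8}
      else if k = 2 then (\<lambda>p q. weight2_factor p * unit_vec p q) ` {..<8} \<union> relation_vec ` {4..<8}
      else if k = 3 then unit_vec ` {4..<8} \<union> relation_vec ` {4..<8}
      else relation_vec ` {4..<8})"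

definition weight_lattice :: "nat \<Rightarrow> (nat \<Rightarrow> int) set" where
  "weight_lattice k = group_closure (weight_generators k)"

lemma group_closure_sum_mem:
  "(\<And>i. i \<in> I \<Longrightarrow> f i \<in> group_closure G) \<Longrightarrow> sum f I \<in> group_closure G"
  by (induction I rule: infinite_finite_induct) (simp_all add: group_closure_add)

lemma group_closure_scale:
  fixes x :: "nat \<Rightarrow> int"
  assumes "x \<in> group_closure G"
  shows "(\<lambda>q. c * x q) \<in> group_closure G"
proof -
  have nat: "(\<lambda>q. int n * x q) \<in> group_closure G" for n
  proof (induction n)
    case 0
    have "(\<lambda>q. int 0 * x q) = 0" by (simp add: fun_eq_iff)
    then show ?case by (simp only: zero_in_group_closure)
  next
    case (Suc n)
    have "(\<lambda>q. int (Suc n) * x q) = x + (\<lambda>q. int n * x q)"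
      by (simp add: fun_eq_iff algebra_simps)
    with assms Suc show ?case by (metis group_closure_add)
  qed
  show ?thesis
  proof (cases "0 \<le> c")
    case True
    with nat[of "nat c"] show ?thesis by simp
  next
    case False
    have "(\<lambda>q. c * x q) = - (\<lambda>q. int (nat (- c)) * x q)" using False by (simp add: fun_eq_iff)
    with nat[of "nat (- c)"] show ?thesis by (metis group_closure_minus_iff)
  qed
qed

lemma sum_apply: "sum f I q = (\<Sum>i\<in>I. f i q)"
  for f :: "'i \<Rightarrow> 'a \<Rightarrow> 'b::comm_monoid_add"
  by (induction I rule: infinite_finite_induct) simp_all

lemma unit_vec_expansion:
  assumes "\<And>q. 8 \<le> q \<Longrightarrow> x q = 0"
  shows "x = (\<Sum>p<8. (\<lambda>q. x p * unit_vec p q))"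
proof
  fix q
  have "(\<Sum>p<8. (\<lambda>q. x p * unit_vec p q)) q = (\<Sum>p<8. x p * unit_vec p q)"
    by (rule sum_apply)
  also have "\<dots> = (\<Sum>p<8. if p = q then x q else 0)"
    by (rule sum.cong) (auto simp: unit_vec_def)
  also have "\<dots> = x q" using assms[of q] by simp
  finally show "x q = (\<Sum>p<8. (\<lambda>q. x p * unit_vec p q)) q" by simp
qed

lemma weight_lattice_1I:
  assumes "\<And>q. 8 \<le> q \<Longrightarrow> x q = 0"
  shows "x \<in> weight_lattice 1"
proof -
  have "(\<Sum>p<8. (\<lambda>q. x p * unit_vec p q)) \<in> weight_lattice 1"
    unfolding weight_lattice_def
    by (intro group_closure_sum_mem group_closure_scale group_closure.base) (simp add: weight_generators_def)
  with unit_vec_expansion[OF assms] show ?thesis by simp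
qed

lemma group_closure_subset:
  assumes "G \<subseteq> group_closure H"
  shows "group_closure G \<subseteq> group_closure H"
proof
  fix x assume "x \<in> group_closure G"
  then show "x \<in> group_closure H"
    by induction (use assms in \<open>auto intro: group_closure.diff\<close>)
qed

lemma relation_vec_beyond: "4 \<le> p \<Longrightarrow> p < 8 \<Longrightarrow> 8 \<le> q \<Longrightarrow> relation_vec p q = 0"
  by (simp add: relation_vec_def zeta_pair_def)

lemma weight_lattice_subset_1: "weight_lattice k \<subseteq> weight_lattice 1"
proof -
  have "weight_generators k \<subseteq> weight_lattice 1"
  proof
    fix x assume "x \<in> weight_generators k"
    then have "x q = 0" if "8 \<le> q" for q
      using that by (auto simp: weight_generators_def unit_vec_def relation_vec_beyond split: if_splits)
    then show "x \<in> weight_lattice 1" by (rule weight_lattice_1I)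
  qed
  then show ?thesis unfolding weight_lattice_def by (rule group_closure_subset)
qed

lemma weight_lattice_3_subset_2: "weight_lattice 3 \<subseteq> weight_lattice 2"
proof -
  have "unit_vec p \<in> weight_generators 2" if "p \<in> {4..<8}" for p
    using that by (auto simp: weight_generators_def weight2_factor_def image_iff bexI[of _ p])
  moreover have "relation_vec p \<in> weight_generators 2" if "p \<in> {4..<8}" for p
    using that by (simp add: weight_generators_def)
  ultimately have "weight_generators 3 \<subseteq> weight_generators 2" by (auto simp: weight_generators_def[of 3])
  then have "weight_generators 3 \<subseteq> weight_lattice 2"
    by (auto simp: weight_lattice_def intro: group_closure.base)
  then show ?thesis unfolding weight_lattice_def by (rule group_closure_subset)
qed

lemma weight_lattice_beyond_4: "4 \<le> k \<Longrightarrow> weight_lattice k = weight_lattice 4"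
  by (simp add: weight_lattice_def weight_generators_def)

lemma weight_lattice_Suc_subset: "weight_lattice (Suc k) \<subseteq> weight_lattice k"
proof -
  consider "k \<le> 1" | "k = 2" | "k = 3" | "4 \<le> k" by linarith
  then show ?thesis
  proof cases
    case 1
    then have "weight_lattice k = weight_lattice 1" by (simp add: weight_lattice_def weight_generators_def)
    then show ?thesis using weight_lattice_subset_1 by simp
  next
    case 2
    then show ?thesis using weight_lattice_3_subset_2 by (simp add: eval_nat_numeral)
  next
    case 3
    have "weight_generators 4 \<subseteq> weight_lattice 3"
      unfolding weight_lattice_def by (auto simp: weight_generators_def intro!: group_closure.base)
    with 3 show ?thesis unfolding weight_lattice_def by (simp add: group_closure_subset)
  next
    case 4
    then show ?thesis using weight_lattice_beyond_4[of k] weight_lattice_beyond_4[of "Suc k"] by simp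
  qed
qed

text \<open>
  The coordinate of \<open>[[x, y], z]\<close> in degree 3.
\<close>

definition bracket_form :: "(nat \<Rightarrow> int) \<Rightarrow> (nat \<Rightarrow> int) \<Rightarrow> (nat \<Rightarrow> int) \<Rightarrow> int" where
  "bracket_form x y z = pairing (wedge x y) z"

lemma bracket_form_diff:
  "bracket_form (x - x') y z = bracket_form x y z - bracket_form x' y z"
  "bracket_form x (y - y') z = bracket_form x y z - bracket_form x y' z"
  "bracket_form x y (z - z') = bracket_form x y z - bracket_form x y z'"
  by (simp_all add: bracket_form_def model_ops)

lemma bracket_form_zero [simp]:
  "bracket_form 0 y z = 0" "bracket_form x 0 z = 0" "bracket_form x y 0 = 0"
  by (simp_all add: bracket_form_def)

lemma bracket_form_scale:
  "bracket_form (\<lambda>p. c * x p) y z = c * bracket_form x y z"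
  "bracket_form x (\<lambda>p. c * y p) z = c * bracket_form x y z"
  "bracket_form x y (\<lambda>p. c * z p) = c * bracket_form x y z"
proof -
  have "wedge (\<lambda>p. c * x p) y = (\<lambda>p q. c * wedge x y p q)"
    "wedge x (\<lambda>p. c * y p) = (\<lambda>p q. c * wedge x y p q)"
    by (simp_all add: wedge_def fun_eq_iff algebra_simps)
  then show "bracket_form (\<lambda>p. c * x p) y z = c * bracket_form x y z"
    "bracket_form x (\<lambda>p. c * y p) z = c * bracket_form x y z"
    by (simp_all add: bracket_form_def pairing_scale_left)
qed (simp add: bracket_form_def pairing_scale_right)

lemma bracket_form_swap: "bracket_form y x z = - bracket_form x y z"
  by (simp add: bracket_form_def wedge_commute[of x y] pairing_minus_left)

lemma bracket_form_jacobi: "bracket_form x y z = bracket_form x z y - bracket_form y z x"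
  using pairing_wedge_jacobi[of x y z] wedge_commute[of x z]
  by (simp add: bracket_form_def pairing_minus_left)

lemma bracket_form_sum_left:
  "bracket_form (\<Sum>i\<in>I. x i) y z = (\<Sum>i\<in>I. bracket_form (x i) y z)"
proof (induction I rule: infinite_finite_induct)
  case (insert i I)
  then show ?case
    by (simp add: bracket_form_def model_ops del: plus_fun_apply)
qed (simp_all del: zero_fun_apply)

lemma sum_mult_unit_vec: "r < 8 \<Longrightarrow> (\<Sum>c<8. g c * unit_vec r c) = g r"
  by (simp add: unit_vec_def if_distrib cong: if_cong)

lemma bracket_form_unit_vec:
  assumes "p < 8" "q < 8" "r < 8"
  shows "bracket_form (unit_vec p) (unit_vec q) (unit_vec r) = on_bracket form_coeff p q r"
proof -
  have pick: "(\<Sum>a<8. \<Sum>b<8. \<Sum>c<8. form_coeff a b c * (unit_vec p a * unit_vec q b * unit_vec r c))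
      = form_coeff p q r" if "p < 8" "q < 8" "r < 8" for p q r
    by (simp only: mult.assoc[symmetric] sum_mult_unit_vec that)
  have "bracket_form (unit_vec p) (unit_vec q) (unit_vec r) =
      (\<Sum>a<8. \<Sum>b<8. \<Sum>c<8. form_coeff a b c * (unit_vec p a * unit_vec q b * unit_vec r c))
      - (\<Sum>a<8. \<Sum>b<8. \<Sum>c<8. form_coeff a b c * (unit_vec q a * unit_vec p b * unit_vec r c))
      - (\<Sum>a<8. \<Sum>b<8. \<Sum>c<8. form_coeff a b c * (unit_vec r a * unit_vec p b * unit_vec q c))
      + (\<Sum>a<8. \<Sum>b<8. \<Sum>c<8. form_coeff a b c * (unit_vec r a * unit_vec q b * unit_vec p c))"
    unfolding bracket_form_def pairing_def wedge_def sum.distrib[symmetric] sum_subtractf[symmetric]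
    by (intro sum.cong refl) (simp add: algebra_simps)
  then show ?thesis using assms by (simp add: pick on_bracket_def)
qed

definition vanishes :: "nat \<Rightarrow> nat \<Rightarrow> nat \<Rightarrow> bool" where
  "vanishes a b c \<longleftrightarrow>
    (\<forall>x\<in>weight_lattice a. \<forall>y\<in>weight_lattice b. \<forall>z\<in>weight_lattice c. 3 ^ 15 dvd bracket_form x y z)"

lemma dvd_on_group_closure:
  fixes f :: "'a::ab_group_add \<Rightarrow> int"
  assumes "x \<in> group_closure G" "\<And>x. x \<in> G \<Longrightarrow> m dvd f x" "\<And>x y. f (x - y) = f x - f y"
  shows "m dvd f x"
  using assms(1)
proof induction
  case (base s)
  have "f 0 = 0" using assms(3)[of 0 0] by simp
  with base assms(2) show ?case by auto
qed (simp add: assms(3))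

lemma vanishesI:
  assumes "\<And>x y z. x \<in> weight_generators a \<Longrightarrow> y \<in> weight_generators b \<Longrightarrow> z \<in> weight_generators c \<Longrightarrow>
    3 ^ 15 dvd bracket_form x y z"
  shows "vanishes a b c"
  unfolding vanishes_def
proof (intro ballI)
  fix x y z assume *: "x \<in> weight_lattice a" "y \<in> weight_lattice b" "z \<in> weight_lattice c"
  have 1: "3 ^ 15 dvd bracket_form x y z" if "x \<in> weight_generators a" "y \<in> weight_generators b" for x y
    by (rule dvd_on_group_closure[OF *(3)[unfolded weight_lattice_def]])
      (fact assms[OF that], simp only: bracket_form_diff)
  have 2: "3 ^ 15 dvd bracket_form x y z" if "x \<in> weight_generators a" for x
    by (rule dvd_on_group_closure[OF *(2)[unfolded weight_lattice_def], of _ "\<lambda>y. bracket_form x y z"])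
      (fact 1[OF that], simp only: bracket_form_diff)
  show "3 ^ 15 dvd bracket_form x y z"
    by (rule dvd_on_group_closure[OF *(1)[unfolded weight_lattice_def], of _ "\<lambda>x. bracket_form x y z"])
      (fact 2, simp only: bracket_form_diff)
qed

lemma vanishes_swap:
  assumes "vanishes a b c"
  shows "vanishes b a c"
  unfolding vanishes_def
proof (intro ballI)
  fix x y z assume "x \<in> weight_lattice b" "y \<in> weight_lattice a" "z \<in> weight_lattice c"
  then have "3 ^ 15 dvd bracket_form y x z" using assms unfolding vanishes_def by blast
  then show "3 ^ 15 dvd bracket_form x y z"
    unfolding bracket_form_swap[of x y] by (simp only: dvd_minus_iff)
qed

text \<open>
  By the Jacobi identity the last argument of a triple bracket can be moved to the first two places.
\<close>

lemma vanishes_last: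
  assumes "vanishes a c b" "vanishes b c a"
  shows "vanishes a b c"
  unfolding vanishes_def
proof (intro ballI)
  fix x y z assume "x \<in> weight_lattice a" "y \<in> weight_lattice b" "z \<in> weight_lattice c"
  then have "3 ^ 15 dvd bracket_form x z y" "3 ^ 15 dvd bracket_form y z x"
    using assms unfolding vanishes_def by blast+
  then show "3 ^ 15 dvd bracket_form x y z"
    unfolding bracket_form_jacobi[of x y z] by (rule dvd_diff)
qed

lemma vanishes_mono:
  "vanishes a b c \<Longrightarrow> weight_lattice a' \<subseteq> weight_lattice a \<Longrightarrow> weight_lattice b' \<subseteq> weight_lattice b \<Longrightarrow>
    weight_lattice c' \<subseteq> weight_lattice c \<Longrightarrow> vanishes a' b' c'"
  unfolding vanishes_def by blast

lemma vanishes_relations: "vanishes 4 1 1"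
proof (rule vanishesI)
  fix x y z assume "x \<in> weight_generators 4" "y \<in> weight_generators 1" "z \<in> weight_generators 1"
  then obtain p q r where x: "x = relation_vec p" "4 \<le> p" "p < 8"
    and yz: "y = unit_vec q" "q < 8" "z = unit_vec r" "r < 8"
    by (auto simp: weight_generators_def)
  have "bracket_form x y z = bracket_form (\<Sum>s<8. (\<lambda>t. relation_vec p s * unit_vec s t)) y z"
    using unit_vec_expansion[of "relation_vec p"] relation_vec_beyond x by simp
  also have "\<dots> = (\<Sum>s<8. relation_vec p s * on_bracket form_coeff s q r)"
    by (simp add: bracket_form_sum_left bracket_form_scale bracket_form_unit_vec yz)
  also have "\<dots> = (\<Sum>s\<leftarrow>[0..<8]. relation_vec p s * on_bracket form_coeff s q r)"
    by (simp add: interv_sum_list_conv_sum_set_nat lessThan_atLeast0)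
  finally show "3 ^ 15 dvd bracket_form x y z"
    using form_relation[OF x(2,3) yz(2,4)] by simp
qed

lemma vanishes_4_any: "vanishes 4 1 1" "vanishes 1 4 1" "vanishes 1 1 4"
  using vanishes_relations vanishes_swap vanishes_last by blast+

lemma relation_triple:
  assumes "x \<in> weight_generators a" "y \<in> weight_generators b" "z \<in> weight_generators c"
    and "x \<in> relation_vec ` {4..<8} \<or> y \<in> relation_vec ` {4..<8} \<or> z \<in> relation_vec ` {4..<8}"
  shows "3 ^ 15 dvd bracket_form x y z"
proof -
  have "v \<in> weight_lattice 1" if "v \<in> weight_generators k" for v k
    using that weight_lattice_subset_1[of k] group_closure.base[of v] by (auto simp: weight_lattice_def)
  then have 1: "x \<in> weight_lattice 1" "y \<in> weight_lattice 1" "z \<in> weight_lattice 1" using assms(1-3) by blast+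
  have "v \<in> weight_lattice 4" if "v \<in> relation_vec ` {4..<8}" for v
    using that by (simp add: weight_lattice_def weight_generators_def group_closure.base)
  with 1 assms(4) vanishes_4_any show ?thesis unfolding vanishes_def by blast
qed

lemma vanishes_3_2_2: "vanishes 3 2 2"
proof (rule vanishesI)
  fix x y z assume gens: "x \<in> weight_generators 3" "y \<in> weight_generators 2" "z \<in> weight_generators 2"
  show "3 ^ 15 dvd bracket_form x y z"
  proof (cases "x \<in> relation_vec ` {4..<8} \<or> y \<in> relation_vec ` {4..<8} \<or> z \<in> relation_vec ` {4..<8}")
    case True
    then show ?thesis using relation_triple gens by blast
  next
    case False
    with gens obtain p q r where x: "x = unit_vec p" "4 \<le> p" "p < 8"
      and yz: "y = (\<lambda>s. weight2_factor q * unit_vec q s)" "q < 8"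
        "z = (\<lambda>s. weight2_factor r * unit_vec r s)" "r < 8"
      by (auto simp: weight_generators_def)
    have "bracket_form x y z = weight2_factor q * weight2_factor r * on_bracket form_coeff p q r"
      by (simp add: x yz bracket_form_scale bracket_form_unit_vec)
    then show ?thesis using form_weight_3_2_2[OF x(2,3) yz(2,4)] by simp
  qed
qed

lemma vanishes_3_1_3: "vanishes 3 1 3"
proof (rule vanishesI)
  fix x y z assume gens: "x \<in> weight_generators 3" "y \<in> weight_generators 1" "z \<in> weight_generators 3"
  show "3 ^ 15 dvd bracket_form x y z"
  proof (cases "x \<in> relation_vec ` {4..<8} \<or> y \<in> relation_vec ` {4..<8} \<or> z \<in> relation_vec ` {4..<8}")
    case True
    then show ?thesis using relation_triple gens by blast
  next
    case False
    with gens obtain p q r where *: "x = unit_vec p" "4 \<le> p" "p < 8"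
      "y = unit_vec q" "q < 8" "z = unit_vec r" "4 \<le> r" "r < 8"
      by (auto simp: weight_generators_def)
    then have "bracket_form x y z = on_bracket form_coeff p q r"
      by (simp add: bracket_form_unit_vec)
    then show ?thesis using form_two_zetas[OF *(2,3,5,7,8)] by simp
  qed
qed

text \<open>
  If no weight exceeds 3 and their sum is at least 7, then there are two entries of weight 3, or one
  of weight 3 and two of weight 2. Antisymmetry and the Jacobi identity reduce every order of the arguments to one order.
\<close>

lemma vanishes_weight_7:
  assumes "1 \<le> a" "1 \<le> b" "1 \<le> c" "7 \<le> a + b + c"
  shows "vanishes a b c"
proof -
  have s: "vanishes 3 1 3" "vanishes 1 3 3" "vanishes 3 3 1"
    using vanishes_3_1_3 vanishes_swap vanishes_last by blast+
  have t: "vanishes 3 2 2" "vanishes 2 3 2" "vanishes 2 2 3"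
    using vanishes_3_2_2 vanishes_swap vanishes_last by blast+
  consider "4 \<le> a" | "4 \<le> b" | "4 \<le> c" | "a = 3" "b = 3" | "a = 3" "c = 3" | "b = 3" "c = 3"
    | "a = 3" "b = 2" "c = 2" | "a = 2" "b = 3" "c = 2" | "a = 2" "b = 2" "c = 3"
    using assms by linarith
  then show ?thesis
  proof cases
    case 1 then show ?thesis
      using vanishes_mono[OF vanishes_4_any(1) _ weight_lattice_subset_1 weight_lattice_subset_1] weight_lattice_beyond_4 by blast
  next
    case 2 then show ?thesis
      using vanishes_mono[OF vanishes_4_any(2) weight_lattice_subset_1 _ weight_lattice_subset_1] weight_lattice_beyond_4 by blast
  next
    case 3 then show ?thesis
      using vanishes_mono[OF vanishes_4_any(3) weight_lattice_subset_1 weight_lattice_subset_1] weight_lattice_beyond_4 by blast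
  next
    case 4 then show ?thesis
      using vanishes_mono[OF s(3) _ _ weight_lattice_subset_1] by blast
  next
    case 5 then show ?thesis
      using vanishes_mono[OF s(1) _ weight_lattice_subset_1] by blast
  next
    case 6 then show ?thesis
      using vanishes_mono[OF s(2) weight_lattice_subset_1] by blast
  qed (use t in simp_all)
qed

section \<open>The weight filtration\<close>

text \<open>
  In degree 2 it suffices to remember what an element must satisfy for its brackets with vectors to
  respect weights. Taking all elements with this property is simpler than generating them by brackets.
\<close>

definition weight_lattice2 :: "nat \<Rightarrow> (nat \<Rightarrow> nat \<Rightarrow> int) set" where
  "weight_lattice2 k = {S. \<forall>j z. 1 \<le> j \<longrightarrow> 7 \<le> k + j \<longrightarrow> z \<in> weight_lattice j \<longrightarrow> 3 ^ 15 dvd pairing S z}"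

lemma weight_lattice_zero: "0 \<in> weight_lattice k"
  and weight_lattice_add: "x \<in> weight_lattice k \<Longrightarrow> y \<in> weight_lattice k \<Longrightarrow> x + y \<in> weight_lattice k"
  and weight_lattice_diff: "x \<in> weight_lattice k \<Longrightarrow> y \<in> weight_lattice k \<Longrightarrow> x - y \<in> weight_lattice k"
  and weight_lattice_scale: "x \<in> weight_lattice k \<Longrightarrow> (\<lambda>q. c * x q) \<in> weight_lattice k"
  unfolding weight_lattice_def
  by (rule zero_in_group_closure group_closure_add group_closure.diff group_closure_scale; assumption)+

lemma weight_lattice2_zero: "0 \<in> weight_lattice2 k"
  by (simp add: weight_lattice2_def del: zero_fun_apply)

lemma weight_lattice2_add: "S \<in> weight_lattice2 k \<Longrightarrow> T \<in> weight_lattice2 k \<Longrightarrow> S + T \<in> weight_lattice2 k"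
  by (simp add: weight_lattice2_def pairing_add_left del: plus_fun_apply)

lemma weight_lattice2_diff: "S \<in> weight_lattice2 k \<Longrightarrow> T \<in> weight_lattice2 k \<Longrightarrow> S - T \<in> weight_lattice2 k"
  unfolding weight_lattice2_def mem_Collect_eq pairing_diff_left by (blast intro: dvd_diff)

lemma weight_lattice2_scale: "S \<in> weight_lattice2 k \<Longrightarrow> (\<lambda>p q. c * S p q) \<in> weight_lattice2 k"
  by (simp add: weight_lattice2_def pairing_scale_left)

lemma weight_lattice2_sum: "(\<And>i. i \<in> I \<Longrightarrow> S i \<in> weight_lattice2 k) \<Longrightarrow> sum S I \<in> weight_lattice2 k"
proof (induction I rule: infinite_finite_induct)
  case (insert i I)
  then show ?case by (simp only: sum.insert weight_lattice2_add insertI1 insertI2 not_False_eq_True)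
qed (simp_all only: sum.infinite sum.empty weight_lattice2_zero not_False_eq_True)

lemma weight_lattice2D:
  "S \<in> weight_lattice2 k \<Longrightarrow> z \<in> weight_lattice j \<Longrightarrow> 1 \<le> j \<Longrightarrow> 7 \<le> k + j \<Longrightarrow> 3 ^ 15 dvd pairing S z"
  by (simp add: weight_lattice2_def)

lemma wedge_in_weight_lattice2:
  assumes "x \<in> weight_lattice a" "y \<in> weight_lattice b" "1 \<le> a" "1 \<le> b"
  shows "wedge x y \<in> weight_lattice2 (a + b)"
  unfolding weight_lattice2_def
proof (safe)
  fix j z assume "1 \<le> j" "7 \<le> a + b + j" "z \<in> weight_lattice j"
  then have "vanishes a b j" using assms by (intro vanishes_weight_7)
  with assms(1,2) \<open>z \<in> weight_lattice j\<close> show "3 ^ 15 dvd pairing (wedge x y) z"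
    unfolding vanishes_def bracket_form_def by blast
qed

definition coeff1 :: "(nat \<Rightarrow> int poly) \<Rightarrow> nat \<Rightarrow> nat \<Rightarrow> int" where
  "coeff1 X n = (\<lambda>p. coeff (X p) n)"

definition coeff2 :: "(nat \<Rightarrow> nat \<Rightarrow> int poly) \<Rightarrow> nat \<Rightarrow> nat \<Rightarrow> nat \<Rightarrow> int" where
  "coeff2 S n = (\<lambda>p q. coeff (S p q) n)"

lemma coeff1_zero [simp]: "coeff1 0 n = 0"
  and coeff1_diff: "coeff1 (X - Y) n = coeff1 X n - coeff1 Y n"
  and coeff1_pderiv: "coeff1 (scale1 c (pderiv1 X)) n = (\<lambda>p. c * int (Suc n) * coeff1 X (Suc n) p)"
  by (simp_all add: coeff1_def fun_eq_iff scale1_def pderiv1_def coeff_pderiv of_int_poly)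

lemma coeff2_zero [simp]: "coeff2 0 n = 0"
  and coeff2_add: "coeff2 (S + T) n = coeff2 S n + coeff2 T n"
  and coeff2_diff: "coeff2 (S - T) n = coeff2 S n - coeff2 T n"
  and coeff2_pderiv: "coeff2 (scale2 c (pderiv2 S)) n = (\<lambda>p q. c * int (Suc n) * coeff2 S (Suc n) p q)"
  by (simp_all add: coeff2_def fun_eq_iff scale2_def pderiv2_def coeff_pderiv of_int_poly)

lemma coeff2_wedge: "coeff2 (wedge X Y) n = (\<Sum>i\<le>n. wedge (coeff1 X i) (coeff1 Y (n - i)))"
proof (intro ext)
  fix p q
  have "coeff2 (wedge X Y) n p q = coeff (X p * Y q) n - coeff (X q * Y p) n"
    by (simp add: coeff2_def wedge_def mult.commute)
  also have "\<dots> = (\<Sum>i\<le>n. coeff (X p) i * coeff (Y q) (n - i) - coeff (X q) i * coeff (Y p) (n - i))"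
    by (simp only: coeff_mult sum_subtractf)
  also have "\<dots> = (\<Sum>i\<le>n. wedge (coeff1 X i) (coeff1 Y (n - i))) p q"
    unfolding sum_apply by (intro sum.cong refl) (simp add: wedge_def coeff1_def)
  finally show "coeff2 (wedge X Y) n p q = (\<Sum>i\<le>n. wedge (coeff1 X i) (coeff1 Y (n - i))) p q" .
qed

lemma coeff_pairing: "coeff (pairing S z) n = (\<Sum>i\<le>n. pairing (coeff2 S i) (coeff1 z (n - i)))"
proof -
  have "coeff (of_int (form_coeff p q r) * (S p q * z r - z p * S q r)) n =
      (\<Sum>i\<le>n. form_coeff p q r * (coeff (S p q) i * coeff (z r) (n - i) - coeff (z p) (n - i) * coeff (S q r) i))"
    for p q r
  proof -
    have "coeff (of_int (form_coeff p q r) * (S p q * z r - z p * S q r)) n =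
        form_coeff p q r * (coeff (S p q * z r) n - coeff (S q r * z p) n)"
      by (simp add: of_int_poly mult.commute)
    also have "\<dots> = form_coeff p q r *
        (\<Sum>i\<le>n. coeff (S p q) i * coeff (z r) (n - i) - coeff (S q r) i * coeff (z p) (n - i))"
      by (simp only: coeff_mult sum_subtractf)
    finally show ?thesis by (simp only: sum_distrib_left mult.commute[of "coeff (S q r) _"])
  qed
  then show ?thesis
    by (simp add: pairing_def coeff_sum coeff1_def coeff2_def sum.swap[of _ "{..<8}" "{..n}"])
qed

text \<open>
  Lowering the degree in \<open>t\<close> by 1 must raise the weight by 1, so the coefficient of \<open>t\<^sup>n\<close> in an element of
  weight \<open>w\<close> has weight \<open>n + w\<close>. In degree 3 weights below 7 impose no condition and weight 7 means
  zero modulo \<open>3\<^bsup>15\<^esup>\<close>. The derivation has weight 1.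
\<close>

definition filtration :: "nat \<Rightarrow> model set" where
  "filtration w = {x.
     (\<forall>n. coeff1 (deg1 x) n \<in> weight_lattice (n + w)) \<and>
     (\<forall>n. coeff2 (deg2 x) n \<in> weight_lattice2 (n + w)) \<and>
     (\<forall>n. 7 \<le> n + w \<longrightarrow> 3 ^ 15 dvd coeff (deg3 x) n) \<and>
     (2 \<le> w \<longrightarrow> der x = 0)}"

lemma filtration_zero: "0 \<in> filtration w"
  by (simp add: filtration_def zero_model_def weight_lattice_zero weight_lattice2_zero del: zero_fun_apply)

lemma filtration_diff: "x \<in> filtration w \<Longrightarrow> y \<in> filtration w \<Longrightarrow> x - y \<in> filtration w"
  unfolding filtration_def minus_model_def mem_Collect_eq model.sel coeff1_diff coeff2_diff coeff_diff
  by (auto intro: weight_lattice_diff weight_lattice2_diff dvd_diff)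

lemma filtration_add: "x \<in> filtration w \<Longrightarrow> y \<in> filtration w \<Longrightarrow> x + y \<in> filtration w"
  using filtration_diff[of x w "0 - y"] filtration_diff[OF filtration_zero, of y w] by simp

lemma filtration_Suc_subset: "filtration (Suc w) \<subseteq> filtration w"
proof -
  have "weight_lattice2 (Suc k) \<subseteq> weight_lattice2 k" for k by (auto simp: weight_lattice2_def)
  then show ?thesis using weight_lattice_Suc_subset by (auto simp: filtration_def subset_iff)
qed

text \<open>
  The coefficients of products are convolutions, for which weights add up; the derivation shifts
  coefficients by one place, which accounts for its weight 1.
\<close>

lemma filtration_bracket:
  assumes x: "x \<in> filtration w" and y: "y \<in> filtration 1" and w: "1 \<le> w"
  shows "\<langle>x, y\<rangle> \<in> filtration (Suc w)"
proof -
  have x1: "coeff1 (deg1 x) n \<in> weight_lattice (n + w)" and x2: "coeff2 (deg2 x) n \<in> weight_lattice2 (n + w)"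
    and x3: "7 \<le> n + w \<Longrightarrow> 3 ^ 15 dvd coeff (deg3 x) n" and x0: "2 \<le> w \<Longrightarrow> der x = 0" for n
    using x by (auto simp: filtration_def)
  have y1: "coeff1 (deg1 y) n \<in> weight_lattice (n + 1)" and y2: "coeff2 (deg2 y) n \<in> weight_lattice2 (n + 1)"
    and y3: "7 \<le> n + 1 \<Longrightarrow> 3 ^ 15 dvd coeff (deg3 y) n" for n
    using y by (auto simp: filtration_def)
  have w1: "w = 1 \<or> der x = 0" using x0 w by linarith
  have "coeff1 (deg1 \<langle>x, y\<rangle>) n \<in> weight_lattice (n + Suc w)" for n
  proof -
    have "coeff1 (scale1 (der x) (pderiv1 (deg1 y))) n \<in> weight_lattice (n + Suc w)"
      unfolding coeff1_pderiv using w1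
    proof
      assume "w = 1"
      then show "(\<lambda>p. der x * int (Suc n) * coeff1 (deg1 y) (Suc n) p) \<in> weight_lattice (n + Suc w)"
        using weight_lattice_scale[OF y1[of "Suc n"]] by simp
    next
      assume "der x = 0"
      then show "(\<lambda>p. der x * int (Suc n) * coeff1 (deg1 y) (Suc n) p) \<in> weight_lattice (n + Suc w)"
        using weight_lattice_zero by (simp add: zero_fun_def)
    qed
    moreover have "coeff1 (scale1 (der y) (pderiv1 (deg1 x))) n \<in> weight_lattice (n + Suc w)"
      unfolding coeff1_pderiv using weight_lattice_scale[OF x1[of "Suc n"]] by simp
    ultimately show ?thesis by (simp only: lie_model_def model.sel coeff1_diff weight_lattice_diff)
  qed
  moreover have "coeff2 (deg2 \<langle>x, y\<rangle>) n \<in> weight_lattice2 (n + Suc w)" for n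
  proof -
    have "wedge (coeff1 (deg1 x) i) (coeff1 (deg1 y) (n - i)) \<in> weight_lattice2 (n + Suc w)" if "i \<le> n" for i
      using wedge_in_weight_lattice2[OF x1[of i] y1[of "n - i"]] w that by (simp add: add.commute)
    then have "coeff2 (wedge (deg1 x) (deg1 y)) n \<in> weight_lattice2 (n + Suc w)"
      unfolding coeff2_wedge by (intro weight_lattice2_sum) simp
    moreover have "coeff2 (scale2 (der x) (pderiv2 (deg2 y))) n \<in> weight_lattice2 (n + Suc w)"
      unfolding coeff2_pderiv using w1
    proof
      assume "w = 1"
      then show "(\<lambda>p q. der x * int (Suc n) * coeff2 (deg2 y) (Suc n) p q) \<in> weight_lattice2 (n + Suc w)"
        using weight_lattice2_scale[OF y2[of "Suc n"]] by simp
    next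
      assume "der x = 0"
      then show "(\<lambda>p q. der x * int (Suc n) * coeff2 (deg2 y) (Suc n) p q) \<in> weight_lattice2 (n + Suc w)"
        using weight_lattice2_zero by (simp add: zero_fun_def)
    qed
    moreover have "coeff2 (scale2 (der y) (pderiv2 (deg2 x))) n \<in> weight_lattice2 (n + Suc w)"
      unfolding coeff2_pderiv using weight_lattice2_scale[OF x2[of "Suc n"]] by simp
    ultimately show ?thesis
      by (simp only: lie_model_def model.sel coeff2_diff coeff2_add weight_lattice2_diff weight_lattice2_add)
  qed
  moreover have "3 ^ 15 dvd coeff (deg3 \<langle>x, y\<rangle>) n" if n: "7 \<le> n + Suc w" for n
  proof -
    have "3 ^ 15 dvd pairing (coeff2 (deg2 x) i) (coeff1 (deg1 y) (n - i))" if "i \<le> n" for i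
      using that n by (intro weight_lattice2D[OF x2 y1]) simp_all
    then have "3 ^ 15 dvd coeff (pairing (deg2 x) (deg1 y)) n"
      unfolding coeff_pairing by (intro dvd_sum) simp
    moreover have "3 ^ 15 dvd pairing (coeff2 (deg2 y) i) (coeff1 (deg1 x) (n - i))" if "i \<le> n" for i
      using that n w by (intro weight_lattice2D[OF y2 x1]) simp_all
    then have "3 ^ 15 dvd coeff (pairing (deg2 y) (deg1 x)) n"
      unfolding coeff_pairing by (intro dvd_sum) simp
    moreover have "3 ^ 15 dvd coeff (of_int (der x) * pderiv (deg3 y)) n"
      using w1 y3[of "Suc n"] n by (auto simp: of_int_poly coeff_pderiv)
    moreover have "3 ^ 15 dvd coeff (of_int (der y) * pderiv (deg3 x)) n"
      using x3[of "Suc n"] n by (auto simp: of_int_poly coeff_pderiv)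
    ultimately show ?thesis
      by (simp only: lie_model_def model.sel coeff_diff coeff_add dvd_diff dvd_add)
  qed
  ultimately show ?thesis by (simp add: filtration_def) (simp add: lie_model_def)
qed

section \<open>Evaluation of Lie terms in the model\<close>

text \<open>
  The element \<open>v t\<^sup>n\<close>.
\<close>

definition embed1 :: "(nat \<Rightarrow> int) \<Rightarrow> nat \<Rightarrow> model" where
  "embed1 v n = Model (\<lambda>p. monom (v p) n) 0 0 0"

definition derivation :: model where
  "derivation = Model 0 0 0 1"

lemma embed1_in_filtration: "v \<in> weight_lattice (n + w) \<Longrightarrow> embed1 v n \<in> filtration w"
proof -
  assume v: "v \<in> weight_lattice (n + w)"
  have "coeff1 (\<lambda>p. monom (v p) n) m = (if m = n then v else 0)" for m
    by (auto simp: coeff1_def fun_eq_iff)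
  with v show ?thesis
    by (simp add: filtration_def embed1_def weight_lattice_zero weight_lattice2_zero del: zero_fun_apply)
qed

lemma derivation_in_filtration: "derivation \<in> filtration 1"
  by (simp add: filtration_def derivation_def weight_lattice_zero weight_lattice2_zero del: zero_fun_apply)

lemma embed1_add: "embed1 v n + embed1 v' n = embed1 (v + v') n"
  and embed1_diff: "embed1 v n - embed1 v' n = embed1 (v - v') n"
  by (simp_all add: embed1_def plus_model_def minus_model_def fun_eq_iff add_monom diff_monom)

lemma nmult_embed1: "nmult k (embed1 v n) = embed1 (\<lambda>q. int k * v q) n"
  by (induction k)
    (simp_all add: embed1_def zero_model_def plus_model_def fun_eq_iff add_monom algebra_simps)

lemma derivation_bracket: "\<langle>derivation, embed1 v (Suc 0)\<rangle> = embed1 v 0"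
  by (simp add: derivation_def embed1_def lie_model_def scale1_def scale2_def pderiv1_def
    pderiv2_def pderiv_monom fun_eq_iff wedge_def)

lemma bracket_derivation_twice:
  "\<langle>\<langle>embed1 v 2, derivation\<rangle>, derivation\<rangle> = embed1 (\<lambda>q. 2 * v q) 0"
  by (simp add: derivation_def embed1_def lie_model_def scale1_def scale2_def pderiv1_def
    pderiv2_def pderiv_monom fun_eq_iff wedge_def pderiv_minus minus_monom)

lemma deg3_nmult: "deg3 (nmult k x) = of_nat k * deg3 x"
  by (induction k) (simp_all add: zero_model_def plus_model_def algebra_simps)

lemma deg3_triple_bracket:
  "coeff (deg3 \<langle>\<langle>embed1 x 0, embed1 y 0\<rangle>, embed1 z 0\<rangle>) 0 = bracket_form x y z"
  by (simp add: lie_model_def embed1_def coeff_pairing coeff2_wedge bracket_form_def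
     scale2_def coeff1_def scale1_def)

text \<open>
  The vector \<open>\<zeta>\<^sub>i\<^sub>j\<close> for the four pairs that carry a relation. For the pairs \<open>03\<close> and \<open>12\<close>, whose
  generators \<open>u\<^sub>i\<^sub>j\<close>, \<open>v\<^sub>i\<^sub>j\<close>, \<open>w\<^sub>i\<^sub>j\<close> occur in no relation, it is 0.
\<close>

definition zeta_vec :: "nat \<Rightarrow> nat \<Rightarrow> nat \<Rightarrow> int" where
  "zeta_vec i j = (\<lambda>q. if 4 \<le> q \<and> q < 8 \<and> zeta_pair q = (i, j) then 1 else 0)"

fun label_image :: "gen_label \<Rightarrow> model" where
  "label_image (GE i) = embed1 (unit_vec i) 0"
| "label_image (GA i) = derivation"
| "label_image (GB i) = embed1 (\<lambda>q. weight2_factor i * unit_vec i q) 1"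
| "label_image (GU i j) = embed1 (zeta_vec i j) 2"
| "label_image (GV i j) = derivation"
| "label_image (GW i j) = derivation"

definition gen_image :: "gen \<Rightarrow> model" where
  "gen_image g = label_image (Rep_gen g)"

lemma gen_image_Abs: "l \<in> gen_labels \<Longrightarrow> gen_image (Abs_gen l) = label_image l"
  by (simp add: gen_image_def Abs_gen_inverse)

lemma zeta_vec_cases:
  obtains "zeta_vec i j = 0" | p where "4 \<le> p" "p < 8" "zeta_pair p = (i, j)" "zeta_vec i j = unit_vec p"
proof (cases "\<exists>p. 4 \<le> p \<and> p < 8 \<and> zeta_pair p = (i, j)")
  case True
  then obtain p where p: "4 \<le> p" "p < 8" "zeta_pair p = (i, j)" by blast
  have "q = p" if "4 \<le> q" "q < 8" "zeta_pair q = (i, j)" for q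
  proof -
    have "p \<in> {4, 5, 6, 7}" "q \<in> {4, 5, 6, 7}" using p(1,2) that(1,2) by auto
    moreover have "zeta_pair p = zeta_pair q" using p(3) that(3) by simp
    ultimately show ?thesis by (auto simp: zeta_pair_def)
  qed
  then have "4 \<le> q \<and> q < 8 \<and> zeta_pair q = (i, j) \<longleftrightarrow> q = p" for q
    using p by blast
  then have "zeta_vec i j = unit_vec p"
    by (simp only: zeta_vec_def unit_vec_def)
  then show ?thesis using p that(2) by blast
next
  case False
  then have "zeta_vec i j q = 0" for q unfolding zeta_vec_def by (rule_tac if_not_P) blast
  then have "zeta_vec i j = 0" by (simp add: fun_eq_iff)
  then show ?thesis by (rule that(1))
qed

lemma zeta_vec_in_weight_lattice: "zeta_vec i j \<in> weight_lattice 3"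
proof (cases rule: zeta_vec_cases[of i j])
  case 1
  then show ?thesis using weight_lattice_zero by simp
next
  case (2 p)
  then have "zeta_vec i j \<in> weight_generators 3" by (auto simp: weight_generators_def)
  then show ?thesis unfolding weight_lattice_def by (simp add: group_closure.base)
qed

lemma gen_image_in_filtration: "gen_image g \<in> filtration 1"
proof -
  have e: "embed1 (unit_vec i) 0 \<in> filtration 1" if "i \<le> 3" for i
  proof (rule embed1_in_filtration)
    show "unit_vec i \<in> weight_lattice (0 + 1)"
      unfolding add_0 using that by (intro weight_lattice_1I) (simp add: unit_vec_def)
  qed
  have b: "embed1 (\<lambda>q. weight2_factor i * unit_vec i q) 1 \<in> filtration 1" if "i \<le> 3" for i
  proof (rule embed1_in_filtration)
    have "(\<lambda>q. weight2_factor i * unit_vec i q) \<in> weight_generators 2"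
      using that by (auto simp: weight_generators_def intro!: imageI)
    then show "(\<lambda>q. weight2_factor i * unit_vec i q) \<in> weight_lattice (1 + 1)"
      unfolding weight_lattice_def one_add_one by (simp add: group_closure.base)
  qed
  have u: "embed1 (zeta_vec i j) 2 \<in> filtration 1" for i j
    using zeta_vec_in_weight_lattice by (intro embed1_in_filtration) simp
  have "label_image l \<in> filtration 1" if "l \<in> gen_labels" for l
    using that e b u derivation_in_filtration by (auto simp: gen_labels_def)
  from this[OF Rep_gen] show ?thesis unfolding gen_image_def .
qed

lemma relation_vec_expansion:
  assumes "4 \<le> p" "p < 8" "zeta_pair p = (i, j)"
  shows "relation_vec p = (\<lambda>q. int (3 ^ (12 - i)) * unit_vec j q) + (\<lambda>q. int (3 ^ (12 - j)) * unit_vec i q)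
    - (\<lambda>q. int (3 ^ (12 - 2 * i - 2 * j)) * (2 * unit_vec p q))"
proof -
  consider "p = 4" "i = 0" "j = 1" | "p = 5" "i = 0" "j = 2" | "p = 6" "i = 1" "j = 3"
    | "p = 7" "i = 2" "j = 3"
    using assms by (auto simp: zeta_pair_def split: if_splits)
  then show ?thesis
    by cases (simp_all add: relation_vec_def zeta_pair_def unit_vec_def fun_eq_iff)
qed

text \<open>
  The relations \<open>9\<^bsup>i\<^esup> e\<^sub>i = y\<^sub>i\<close> hold exactly, as \<open>[D, 9\<^bsup>i\<^esup> e\<^sub>i t] = 9\<^bsup>i\<^esup> e\<^sub>i\<close>. The other relations hold up to a
  relation vector, which has infinite weight.
\<close>

lemma relations_in_model:
  assumes "(s, t) \<in> A_rels"
  shows "lterm_eval gen_image s - lterm_eval gen_image t \<in> filtration 7"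
proof -
  from assms consider
    (e) i where "i \<in> {0, 1, 2, 3}" "s = nmult (3 ^ (2 * i)) (lgen (GE i))" "t = y_term i"
  | (z) i j where "(i, j) \<in> {(0, 1), (0, 2), (1, 3), (2, 3)}"
      "s = nmult (3 ^ (12 - i)) (lgen (GE j)) + nmult (3 ^ (12 - j)) (lgen (GE i))"
      "t = nmult (3 ^ (12 - 2 * i - 2 * j)) (yy_term i j)"
    unfolding A_rels_def by blast
  then show ?thesis
  proof cases
    case e
    have i: "i \<le> 3" using e(1) by auto
    have l: "GE i \<in> gen_labels" "GA i \<in> gen_labels" "GB i \<in> gen_labels"
      using i by (auto simp: gen_labels_def)
    have "int (3 ^ (2 * i)) = weight2_factor i"
      using i by (simp add: weight2_factor_def power_mult)
    then have "lterm_eval gen_image s = lterm_eval gen_image t"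
      by (simp add: e(2,3) y_term_def gen_image_Abs l nmult_embed1 derivation_bracket)
    then show ?thesis by (simp add: filtration_zero)
  next
    case z
    then have b: "i < j" "j \<le> 3" by auto
    have l: "GE i \<in> gen_labels" "GE j \<in> gen_labels" "GU i j \<in> gen_labels" "GV i j \<in> gen_labels"
      "GW i j \<in> gen_labels"
      using b by (auto simp: gen_labels_def)
    obtain p where p: "4 \<le> p" "p < 8" "zeta_pair p = (i, j)"
    proof -
      have "zeta_pair 4 = (0, 1)" "zeta_pair 5 = (0, 2)" "zeta_pair 6 = (1, 3)" "zeta_pair 7 = (2, 3)"
        by (simp_all add: zeta_pair_def)
      then show ?thesis using z(1) that[of 4] that[of 5] that[of 6] that[of 7] by auto
    qed
    then have "zeta_vec i j p = 1" by (simp add: zeta_vec_def)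
    then have zeta: "zeta_vec i j = unit_vec p"
      by (cases rule: zeta_vec_cases[of i j]) (auto simp: unit_vec_def split: if_splits)
    have "lterm_eval gen_image s - lterm_eval gen_image t = embed1 (relation_vec p) 0"
    proof -
      have img: "gen_image (Abs_gen (GE i)) = embed1 (unit_vec i) 0"
        "gen_image (Abs_gen (GE j)) = embed1 (unit_vec j) 0"
        "gen_image (Abs_gen (GU i j)) = embed1 (unit_vec p) 2"
        "gen_image (Abs_gen (GV i j)) = derivation" "gen_image (Abs_gen (GW i j)) = derivation"
        by (simp_all only: gen_image_Abs l label_image.simps zeta)
      show ?thesis
        unfolding z(2,3) yy_term_def lterm_eval_ops lterm_eval_nmult lterm_eval.simps img
          nmult_embed1 bracket_derivation_twice embed1_add embed1_diff relation_vec_expansion[OF p] ..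
    qed
    moreover have "relation_vec p \<in> weight_lattice (0 + 7)"
      using p unfolding weight_lattice_def by (auto simp: weight_generators_def intro!: group_closure.base)
    ultimately show ?thesis by (simp only: embed1_in_filtration)
  qed
qed

lemma lterm_eval_in_filtration: "lterm_eval gen_image t \<in> filtration 1"
proof (induction t)
  case (LGen g)
  show ?case using gen_image_in_filtration by simp
next
  case (LPlus s t)
  then show ?case by (simp add: filtration_add)
next
  case (LNeg t)
  then show ?case using filtration_diff[OF filtration_zero LNeg] by simp
next
  case (LBr s t)
  then have "\<langle>lterm_eval gen_image s, lterm_eval gen_image t\<rangle> \<in> filtration (Suc 1)"
    by (intro filtration_bracket) simp_all
  then show ?case using filtration_Suc_subset by auto
qed (simp add: filtration_zero)

text \<open>
  The seventh term of the filtration absorbs brackets with images of terms, so congruent terms have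
  equal images modulo it. Working with terms in this way replaces passing to a quotient of the
  model, in which the relations would hold exactly.
\<close>

lemma lie_cong_in_model:
  assumes "lie_cong A_rels s t"
  shows "lterm_eval gen_image s - lterm_eval gen_image t \<in> filtration 7"
  using assms
proof (induction rule: lie_cong.induct)
  case (lc_rel s t)
  then show ?case by (rule relations_in_model)
next
  case (lc_sym s t)
  then show ?case using filtration_diff[OF filtration_zero lc_sym.IH] by simp
next
  case (lc_trans s t u)
  then show ?case using filtration_add[OF lc_trans.IH] by simp
next
  case (lc_plus s s' t t')
  then show ?case using filtration_add[OF lc_plus.IH] by (simp add: algebra_simps)
next
  case (lc_neg t t')
  then show ?case using filtration_diff[OF filtration_zero lc_neg.IH] by simp
next
  case (lc_br s s' t t')
  let ?f = "lterm_eval gen_image"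
  have left: "\<langle>x, ?f u\<rangle> \<in> filtration 7" if "x \<in> filtration 7" for x u
    using filtration_bracket[OF that lterm_eval_in_filtration[of u]] filtration_Suc_subset[of 7] by auto
  have "\<langle>?f s - ?f s', ?f t\<rangle> - \<langle>?f t - ?f t', ?f s'\<rangle> \<in> filtration 7"
    using lc_br.IH left filtration_diff by blast
  moreover have "\<langle>?f s', ?f t - ?f t'\<rangle> = - \<langle>?f t - ?f t', ?f s'\<rangle>"
    by (rule lie_swap)
  moreover have "?f \<langle>s, t\<rangle> - ?f \<langle>s', t'\<rangle> = \<langle>?f s - ?f s', ?f t\<rangle> + \<langle>?f s', ?f t - ?f t'\<rangle>"
    by (simp add: lie_diff_left lie_diff_right)
  ultimately show ?case by simp
next
  case (lc_jacobi s t u)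
  then show ?case by (simp add: lie_jacobi filtration_zero)
qed (simp_all add: filtration_zero lie_add_left lie_add_right lie_self add_ac)

lemma lower_central_in_model:
  assumes "x \<in> lower_central (Suc k)"
  shows "\<exists>t. lterm_eval A_gen t = x \<and> lterm_eval gen_image t \<in> filtration (Suc k)"
  using assms
proof (induction k arbitrary: x)
  case 0
  have "\<exists>t. lterm_eval A_gen t = x"
    by (induct x rule: lie_A.abs_induct) (metis A_eval.abs_eq A_eval_eq)
  then show ?case using lterm_eval_in_filtration by auto
next
  case (Suc k)
  from Suc.prems have "x \<in> group_closure {\<langle>x, y\<rangle> | x y. x \<in> lower_central (Suc k)}" by simp
  then show ?case
  proof induction
    case (base z)
    show ?case
    proof (cases "z = 0")
      case True
      then show ?thesis using filtration_zero by (intro exI[of _ LZero]) simp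
    next
      case False
      with base obtain x y :: lie_A where z: "z = \<langle>x, y\<rangle>" "x \<in> lower_central (Suc k)" by auto
      obtain s where s: "lterm_eval A_gen s = x" "lterm_eval gen_image s \<in> filtration (Suc k)"
        using Suc.IH[OF z(2)] by blast
      obtain t where t: "lterm_eval A_gen t = y"
        by (induct y rule: lie_A.abs_induct) (metis A_eval.abs_eq A_eval_eq)
      have "lterm_eval gen_image (LBr s t) \<in> filtration (Suc (Suc k))"
        using filtration_bracket[OF s(2) lterm_eval_in_filtration[of t]] by simp
      with z s t show ?thesis by (intro exI[of _ "LBr s t"]) simp
    qed
  next
    case (diff x y)
    then obtain s t where st: "lterm_eval A_gen s = x" "lterm_eval A_gen t = y"
      "lterm_eval gen_image s \<in> filtration (Suc (Suc k))"
      "lterm_eval gen_image t \<in> filtration (Suc (Suc k))"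
      by blast
    then have "lterm_eval gen_image (LPlus s (LNeg t)) \<in> filtration (Suc (Suc k))"
      using filtration_diff[OF st(3,4)] by simp
    with st show ?case by (intro exI[of _ "LPlus s (LNeg t)"]) simp
  qed
qed

lemma omega_notin_lower_central: "nmult (3 ^ 9) \<langle>\<langle>e 2, e 1\<rangle>, e 0\<rangle> \<notin> lower_central 7"
proof
  let ?\<omega> = "nmult (3 ^ 9) \<langle>\<langle>lgen (GE 2), lgen (GE 1)\<rangle>, lgen (GE 0)\<rangle>"
  assume "nmult (3 ^ 9) \<langle>\<langle>e 2, e 1\<rangle>, e 0\<rangle> \<in> lower_central 7"
  then have "lterm_eval A_gen ?\<omega> \<in> lower_central 7"
    by (simp only: lterm_eval_nmult lterm_eval_ops lterm_eval.simps e_def)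
  then obtain t where t: "lterm_eval A_gen t = lterm_eval A_gen ?\<omega>"
      "lterm_eval gen_image t \<in> filtration 7"
    using lower_central_in_model[of _ 6] by auto
  have "lie_cong A_rels ?\<omega> t"
    using t(1) unfolding A_eval_eq[symmetric] by transfer (simp add: lc_sym)
  then have "lterm_eval gen_image ?\<omega> - lterm_eval gen_image t + lterm_eval gen_image t \<in> filtration 7"
    by (intro filtration_add lie_cong_in_model t)
  then have "3 ^ 15 dvd coeff (deg3 (lterm_eval gen_image ?\<omega>)) 0"
    by (simp add: filtration_def)
  moreover have "coeff (deg3 (lterm_eval gen_image ?\<omega>)) 0 = 3 ^ 9 * on_bracket form_coeff 2 1 0"
    by (simp add: gen_image_Abs gen_labels_def deg3_nmult deg3_triple_bracket bracket_form_unit_vec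
      of_nat_poly)
  \<comment> \<open>so the value is \<open>4 \<cdot> 3\<^bsup>14\<^esup>\<close>, which is not divisible by \<open>3\<^bsup>15\<^esup>\<close>\<close>
  moreover have "on_bracket form_coeff 2 1 0 = 4 * 3 ^ 5"
    by (simp add: on_bracket_def form_coeff_def word_coeff_def)
  ultimately show False by simp
qed

theorem proposition9p1:
  shows "let \<omega> = nmult (3 ^ 9) \<langle>\<langle>e 2, e 1\<rangle>, e 0\<rangle>
    in \<omega> \<in> dim_subring 7 - lower_central 7 \<and> nmult 3 \<omega> \<in> lower_central 7"
  using omega_in_dim_subring omega_notin_lower_central three_omega_in_lower_central
  by (simp only: Let_def Diff_iff not_False_eq_True simp_thms)

end
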